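(* Let $T$ be a tree. Then \[ \mathrm{sp}^*(T,V(T)) \ge \max\left\{ \left\lceil \frac{2h_1(T)+h_2^*(T)}{3}\right\rceil, \left\lceil \frac{h_1(T)+h_2^*(T)}{2}\right\rceil\right\}. \] Additionally, if all the bunches of $T$ have size at least three and $T$ is not the star $K_{1,3}$, then \[ \mathrm{sp}^*(T,V(T)) \le \left\lceil \frac{2h_1(T)}{3}\right\rceil + \left\lceil \frac{h_2^*(T)+1}{2}\right\rceil. \]
   Context: All graphs are finite, simple and undirected. A path in a graph $G$ is a sequence of distinct vertices $v_0v_1\dots v_l$ ($l\ge 0$) with $v_{i-1}v_i\in E(G)$ for all $i$; it contains the vertices $v_0,\dots,v_l$ and the edges $v_{i-1}v_i$. For $S\subseteq V(G)\cup E(G)$ and a family $\mathcal F$ of paths in $G$, let $\mathcal F(s)$ be the set of paths of $\mathcal F$ containing $s$. $\mathcal F$ separates $S$ if $\mathcal F(s)\neq\mathcal F(t)$ for all distinct $s,t\in S$, and covers $S$ if $\mathcal F(s)\neq\emptyset$ for all $s\in S$. $\mathrm{sp}^*(G,S)$ denotes the minimum size of a family of paths in $G$ that both separates and covers $S$. For a tree $T$: $h_1(T)$ is the number of leaves and $h_2(T)$ the number of degree-2 vertices. An edge $uv$ is interior if neither $u$ nor $v$ is a leaf. A bunch (of leaves) is a connected component with at least one edge of the graph obtained from $T$ by deleting all interior edges; its size is the number of leaves of $T$ it contains. A bare path is a path in which only the two extreme vertices have degree different from two; $T$ has a unique family $\mathcal P$ of (maximal) bare paths partitioning $E(T)$.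 Let $\mathcal I\subseteq\mathcal P$ be the set of those bare paths that contain no leaf and have at least two edges, and set $h_2^*(T)=\sum_{P\in\mathcal P\setminus\mathcal I}(|E(P)|-1)+\sum_{P\in\mathcal I}(|E(P)|-2)$ (equivalently $h_2^*(T)=h_2(T)-|\mathcal I|$). *)

theory Defs
  imports Complex_Main
begin

definition simple_graph :: "'a set \<Rightarrow> 'a set set \<Rightarrow> bool" where
  "simple_graph V E \<longleftrightarrow> finite V \<and> E \<subseteq> {{u, v} | u v. u \<in> V \<and> v \<in> V \<and> u \<noteq> v}"

definition degree :: "'a set set \<Rightarrow> 'a \<Rightarrow> nat" where
  "degree E v = card {e \<in> E. v \<in> e}"

definition is_path :: "'a set \<Rightarrow> 'a set set \<Rightarrow> 'a list \<Rightarrow> bool" where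
  "is_path V E p \<longleftrightarrow> p \<noteq> [] \<and> distinct p \<and> set p \<subseteq> V \<and>
     (\<forall>i. Suc i < length p \<longrightarrow> {p ! i, p ! Suc i} \<in> E)"

definition path_edges :: "'a list \<Rightarrow> 'a set set" where
  "path_edges p = {{p ! i, p ! Suc i} | i. Suc i < length p}"

definition is_cycle :: "'a set \<Rightarrow> 'a set set \<Rightarrow> 'a list \<Rightarrow> bool" where
  "is_cycle V E c \<longleftrightarrow> is_path V E c \<and> 3 \<le> length c \<and> {last c, hd c} \<in> E"

definition joined :: "'a set \<Rightarrow> 'a set set \<Rightarrow> 'a \<Rightarrow> 'a \<Rightarrow> bool" where
  "joined V E u v \<longleftrightarrow> (\<exists>p. is_path V E p \<and> hd p = u \<and> last p = v)"

definition is_tree :: "'a set \<Rightarrow> 'a set set \<Rightarrow> bool" where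
  "is_tree V E \<longleftrightarrow> simple_graph V E \<and> V \<noteq> {} \<and>
     (\<forall>u\<in>V. \<forall>v\<in>V. joined V E u v) \<and> \<not> (\<exists>c. is_cycle V E c)"

text \<open>The sets to be separated may mix vertices and edges, hence a tagged union.\<close>

datatype 'a element = Vertex 'a | Edge "'a set"

fun contains :: "'a list \<Rightarrow> 'a element \<Rightarrow> bool" where
  "contains p (Vertex v) \<longleftrightarrow> v \<in> set p"
| "contains p (Edge e) \<longleftrightarrow> e \<in> path_edges p"

definition paths_through :: "'a list set \<Rightarrow> 'a element \<Rightarrow> 'a list set" where
  "paths_through F s = {p \<in> F. contains p s}"

definition separates :: "'a list set \<Rightarrow> 'a element set \<Rightarrow> bool" where
  "separates F S \<longleftrightarrow> (\<forall>s\<in>S. \<forall>t\<in>S. s \<noteq> t \<longrightarrow> paths_through F s \<noteq> paths_through F t)"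

definition covers :: "'a list set \<Rightarrow> 'a element set \<Rightarrow> bool" where
  "covers F S \<longleftrightarrow> (\<forall>s\<in>S. paths_through F s \<noteq> {})"

text \<open>A path and its reversal are different lists containing the same elements. This does not
  affect the minimum, because having both in a family is never of use.\<close>

definition sp_star :: "'a set \<Rightarrow> 'a set set \<Rightarrow> 'a element set \<Rightarrow> nat" where
  "sp_star V E S = (LEAST k. \<exists>F. finite F \<and> card F = k \<and> (\<forall>p\<in>F. is_path V E p) \<and>
     separates F S \<and> covers F S)"

definition leaf :: "'a set set \<Rightarrow> 'a \<Rightarrow> bool" where
  "leaf E v \<longleftrightarrow> degree E v = 1"

definition h1 :: "'a set \<Rightarrow> 'a set set \<Rightarrow> nat" where
  "h1 V E = card {v \<in> V. leaf E v}"

definition interior_edges :: "'a set set \<Rightarrow> 'a set set" where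
  "interior_edges E = {e \<in> E. \<forall>v\<in>e. \<not> leaf E v}"

definition components :: "'a set \<Rightarrow> 'a set set \<Rightarrow> 'a set set" where
  "components V E = {{v \<in> V. joined V E u v} | u. u \<in> V}"

text \<open>Bunches are given by their vertex sets.\<close>

definition bunches :: "'a set \<Rightarrow> 'a set set \<Rightarrow> 'a set set" where
  "bunches V E =
     {B \<in> components V (E - interior_edges E). \<exists>e \<in> E - interior_edges E. e \<subseteq> B}"

definition bunch_size :: "'a set set \<Rightarrow> 'a set \<Rightarrow> nat" where
  "bunch_size E B = card {v \<in> B. leaf E v}"

definition is_bare_path :: "'a set \<Rightarrow> 'a set set \<Rightarrow> 'a list \<Rightarrow> bool" where
  "is_bare_path V E p \<longleftrightarrow> is_path V E p \<and> 2 \<le> length p \<and>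
     degree E (hd p) \<noteq> 2 \<and> degree E (last p) \<noteq> 2 \<and>
     (\<forall>i. 0 < i \<and> Suc i < length p \<longrightarrow> degree E (p ! i) = 2)"

text \<open>The family of bare paths partitioning the edges of a tree. Each bare path is represented by
  its edge set, so that a path and its reversal are counted once. The requirement on the end
  vertices makes bare paths maximal, so that in a tree this is the whole partition.\<close>

definition bare_paths :: "'a set \<Rightarrow> 'a set set \<Rightarrow> 'a set set set" where
  "bare_paths V E = {path_edges p | p. is_bare_path V E p}"

definition long_inner_bare_paths :: "'a set \<Rightarrow> 'a set set \<Rightarrow> 'a set set set" where
  "long_inner_bare_paths V E =
     {P \<in> bare_paths V E. (\<forall>v \<in> \<Union> P. \<not> leaf E v) \<and> 2 \<le> card P}"

text \<open>The truncated subtractions are exact: all sets in the first sum are nonempty, and those in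
  the second have at least two elements.\<close>

definition h2_star :: "'a set \<Rightarrow> 'a set set \<Rightarrow> nat" where
  "h2_star V E = (\<Sum>P \<in> bare_paths V E - long_inner_bare_paths V E. card P - 1)
     + (\<Sum>P \<in> long_inner_bare_paths V E. card P - 2)"

definition is_star :: "nat \<Rightarrow> 'a set \<Rightarrow> 'a set set \<Rightarrow> bool" where
  "is_star n V E \<longleftrightarrow>
     (\<exists>c\<in>V. finite V \<and> card (V - {c}) = n \<and> E = {{c, v} | v. v \<in> V - {c}})"

end

theory Submission
  imports Defs
begin

text \<open>
  Lower bound. A path contains a leaf only as an end vertex, and it separates the two ends of an edge
  between vertices of degree at most two only by ending there. So a path serves at most two of these
  tasks, of which each leaf poses one for every path through it, and at most one leaf per path can be
  content with a single path. Edges of the second kind number at least \<open>h2_star\<close>.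

  Upper bound. Order the supports (neighbours of leaves) cyclically so that the closed walk visiting
  them crosses every edge at most twice, as in a walk around a planar drawing; such an order is built by
  inserting each vertex directly after a neighbour. Choose three leaves \<open>a\<close>, \<open>b\<close>, \<open>c\<close> at every support \<open>w\<close>
  and take the paths \<open>a w\<close>, \<open>w\<close>, \<open>c w\<close> together with those from \<open>c w\<close> to \<open>b\<close> of the next support. Two
  vertices outside the leaves can only remain unseparated if they lie inside one bare path: if a
  support lies between them, the cyclic order must leave the region between them somewhere, and a
  branching vertex would send four crossings over one edge. The inside of the bare paths is separated
  by extra paths that each end at two of the edges joining vertices of degree two, paired off such that
  two paired edges on the same bare path have another such edge, not yet paired, between them.
\<close>

section \<open>Graphs and paths\<close>

text \<open>\<open>h2_star\<close> enters the two bounds through different edge sets: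
  \<open>card mid_edges <= h2_star V E <= card low_edges\<close>, where an edge at a leaf can count
  only for the latter. The lower bound is a budget of two units per path. With \<open>k\<close>
  paths the leaves use at least \<open>h1 V E\<close> units, and also at least
  \<open>2 * h1 V E - k\<close>, since at most \<open>k\<close> leaves lie on a single path; adding
  one unit per edge of \<open>low_edges\<close> gives both estimates against \<open>2 * k\<close>.
  The ratio 2/3 is reached because two paths have three nonempty subfamilies, one for each of three
  leaves. Bunches of size three let every support run this scheme by itself with one local path and
  one ring path, so no rounding is lost there. The obstacle is a long bare path: a ring path
  contains all or none of its inner vertices. One extra path can stop at two edges, which explains
  the factor 1/2. The summand 1 arises because a path between two edges misses both ends of a
  segment around them, so the last two edges may have to be treated separately.\<close>

lemma path_edges_idx_inj:
  assumes "distinct p" "Suc i < length p" "Suc j < length p"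
    and "{p ! i, p ! Suc i} = {p ! j, p ! Suc j}"
  shows "i = j"
proof -
  have "(p!i = p!j \<and> p!Suc i = p!Suc j) \<or> (p!i = p!Suc j \<and> p!Suc i = p!j)"
    using assms(4) by (auto simp: doubleton_eq_iff)
  then show ?thesis
    using assms(1-3) by (auto simp: nth_eq_iff_index_eq)
qed

lemma is_path_append1: "is_path V E (xs @ ys) \<Longrightarrow> xs \<noteq> [] \<Longrightarrow> is_path V E xs"
  unfolding is_path_def by (auto simp: nth_append split: if_splits)

lemma is_path_append2: "is_path V E (xs @ ys) \<Longrightarrow> ys \<noteq> [] \<Longrightarrow> is_path V E ys"
  by (auto simp: is_path_def) (metis add_Suc_right nat_add_left_cancel_less nth_append_length_plus)

lemma is_path_Cons:
  assumes "is_path V E p" "x \<in> V" "x \<notin> set p" "{x, hd p} \<in> E"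
  shows "is_path V E (x # p)"
  using assms unfolding is_path_def
  by (auto simp: nth_Cons hd_conv_nth split: nat.splits)

lemma is_path_rev:
  assumes "is_path V E p"
  shows "is_path V E (rev p)"
proof -
  have "{rev p ! i, rev p ! Suc i} \<in> E" if i: "Suc i < length p" for i
  proof -
    define j where "j = length p - Suc (Suc i)"
    have "length p - Suc i = Suc j" using i by (simp add: j_def)
    then have j: "Suc j < length p" "rev p ! i = p ! Suc j" "rev p ! Suc i = p ! j"
      using i by (auto simp: rev_nth j_def)
    then show ?thesis using assms by (auto simp: is_path_def insert_commute)
  qed
  then show ?thesis using assms by (auto simp: is_path_def)
qed

lemma is_path_take: "is_path V E p \<Longrightarrow> is_path V E (take (Suc n) p)"
  using is_path_append1[of V E "take (Suc n) p" "drop (Suc n) p"]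
  by (auto simp: is_path_def)

lemma is_path_mono: "is_path V E p \<Longrightarrow> E \<subseteq> E' \<Longrightarrow> is_path V E' p"
  unfolding is_path_def by blast

lemma path_edges_rev_subset: "path_edges (rev p) \<subseteq> path_edges p"
proof
  fix e assume "e \<in> path_edges (rev p)"
  then obtain i where i: "Suc i < length p" "e = {rev p ! i, rev p ! Suc i}"
    by (auto simp: path_edges_def)
  define j where "j = length p - Suc (Suc i)"
  have "length p - Suc i = Suc j" using i(1) by (simp add: j_def)
  then have "Suc j < length p" "rev p ! i = p ! Suc j" "rev p ! Suc i = p ! j"
    using i(1) by (auto simp: rev_nth j_def)
  then show "e \<in> path_edges p" using i(2) by (auto simp: path_edges_def insert_commute)
qed

lemma path_edges_rev: "path_edges (rev p) = path_edges p"
  using path_edges_rev_subset[of p] path_edges_rev_subset[of "rev p"] by simp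

lemma path_edges_subset: "is_path V E p \<Longrightarrow> path_edges p \<subseteq> E"
  by (auto simp: path_edges_def is_path_def)

lemma path_edges_eq_image: "path_edges p = (\<lambda>i. {p ! i, p ! Suc i}) ` {i. Suc i < length p}"
  by (auto simp: path_edges_def)

lemma finite_path_edges: "finite (path_edges p)"
proof -
  have "{i. Suc i < length p} \<subseteq> {..<length p}" by auto
  then have "finite {i. Suc i < length p}" using finite_subset by blast
  then show ?thesis by (simp add: path_edges_eq_image)
qed

lemma card_path_edges: "distinct p \<Longrightarrow> card (path_edges p) = length p - 1"
proof -
  assume p: "distinct p"
  have "{i. Suc i < length p} = {..<length p - 1}" by auto
  moreover have "inj_on (\<lambda>i. {p ! i, p ! Suc i}) {i. Suc i < length p}"
    using path_edges_idx_inj[OF p] by (auto intro!: inj_onI)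
  ultimately show ?thesis by (simp add: path_edges_eq_image card_image)
qed

text \<open>A discrete intermediate value principle; it locates the step at which a path leaves a
  set of vertices.\<close>

lemma path_change:
  assumes "i \<le> j" "P (p ! i)" "\<not> P (p ! j)"
  shows "\<exists>k. i \<le> k \<and> k < j \<and> P (p ! k) \<and> \<not> P (p ! Suc k)"
  using assms
proof (induction "j - i" arbitrary: i)
  case 0 then show ?case by auto
next
  case (Suc d)
  then have "i < j" by linarith
  show ?case
  proof (cases "P (p ! Suc i)")
    case True
    moreover have "d = j - Suc i" "Suc i \<le> j" using Suc.hyps(2) \<open>i < j\<close> by auto
    ultimately obtain k where "Suc i \<le> k \<and> k < j \<and> P (p ! k) \<and> \<not> P (p ! Suc k)"
      using Suc.hyps(1) Suc.prems by blast
    then show ?thesis by (auto intro!: exI[of _ k])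
  next
    case False then show ?thesis using \<open>i < j\<close> Suc.prems by auto
  qed
qed

text \<open>Walks can be shortened to paths: if the vertex to be prepended is already on the path,
  the path is cut at that vertex instead. Transitivity of \<open>joined\<close> then comes from the
  closure.\<close>

lemma joined_iff_rtrancl:
  "joined V E u v \<longleftrightarrow> u \<in> V \<and> (u, v) \<in> {(a, b). a \<in> V \<and> b \<in> V \<and> {a, b} \<in> E}\<^sup>*"
    (is "_ \<longleftrightarrow> _ \<and> _ \<in> ?R\<^sup>*")
proof
  assume "joined V E u v"
  then obtain p where p: "is_path V E p" "hd p = u" "last p = v" by (auto simp: joined_def)
  have "(p ! 0, p ! i) \<in> ?R\<^sup>*" if "i < length p" for i
    using that
  proof (induction i)
    case (Suc i)
    have "(p ! i, p ! Suc i) \<in> ?R"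
      using p(1) Suc.prems by (auto simp: is_path_def)
    then show ?case using Suc by (meson Suc_lessD rtrancl.rtrancl_into_rtrancl)
  qed auto
  moreover have "p \<noteq> []" "u \<in> V" using p by (auto simp: is_path_def)
  ultimately show "u \<in> V \<and> (u, v) \<in> ?R\<^sup>*"
    using p by (auto simp: hd_conv_nth last_conv_nth)
next
  assume "u \<in> V \<and> (u, v) \<in> ?R\<^sup>*"
  then have "(u, v) \<in> ?R\<^sup>*" "u \<in> V" by auto
  then show "joined V E u v"
  proof (induction rule: converse_rtrancl_induct)
    case base
    then show ?case by (auto simp: joined_def is_path_def intro!: exI[of _ "[v]"])
  next
    case (step y z)
    then obtain p where p: "is_path V E p" "hd p = z" "last p = v" by (auto simp: joined_def)
    show ?case
    proof (cases "y \<in> set p")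
      case True
      then obtain xs ys where s: "p = xs @ y # ys" by (meson split_list)
      have "is_path V E (y # ys)" using p(1) s is_path_append2 by blast
      moreover have "last (y # ys) = v" using p s by auto
      ultimately show ?thesis unfolding joined_def by (metis list.sel(1))
    next
      case False
      have "is_path V E (y # p)" using is_path_Cons p step False by auto
      moreover have "last (y # p) = v" using p by (auto simp: is_path_def)
      ultimately show ?thesis unfolding joined_def by (metis list.sel(1))
    qed
  qed
qed

lemma joined_in: "joined V E u v \<Longrightarrow> u \<in> V \<and> v \<in> V"
  unfolding joined_def is_path_def by (metis hd_in_set last_in_set subsetD)

lemma joined_refl: "u \<in> V \<Longrightarrow> joined V E u u"
  by (simp add: joined_iff_rtrancl)

lemma joined_trans: "joined V E u v \<Longrightarrow> joined V E v w \<Longrightarrow> joined V E u w"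
  by (auto simp: joined_iff_rtrancl)

lemma joined_edge: "u \<in> V \<Longrightarrow> v \<in> V \<Longrightarrow> {u, v} \<in> E \<Longrightarrow> joined V E u v"
  by (auto simp: joined_iff_rtrancl)

lemma joined_sym: "joined V E u v \<Longrightarrow> joined V E v u"
  unfolding joined_def
  by (metis hd_rev is_path_rev last_rev)

lemma joined_induct:
  assumes "joined V E u v" "P u"
    and "\<And>a b. P a \<Longrightarrow> a \<in> V \<Longrightarrow> b \<in> V \<Longrightarrow> {a, b} \<in> E \<Longrightarrow> P b"
  shows "P v"
proof -
  have "(u, v) \<in> {(a, b). a \<in> V \<and> b \<in> V \<and> {a, b} \<in> E}\<^sup>*"
    using assms(1) by (simp add: joined_iff_rtrancl)
  then show ?thesis by (induction rule: rtrancl_induct) (use assms in auto)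
qed

section \<open>Degrees, neighbours and leaves in a simple graph\<close>

locale sgraph =
  fixes V :: "'a set" and E :: "'a set set"
  assumes graph: "simple_graph V E"
begin

lemma finite_V: "finite V" using graph by (simp add: simple_graph_def)

lemma edge_obtain: "e \<in> E \<Longrightarrow> \<exists>x y. e = {x, y} \<and> x \<in> V \<and> y \<in> V \<and> x \<noteq> y"
  using graph by (auto simp: simple_graph_def)

lemma edgeD: "{x, y} \<in> E \<Longrightarrow> x \<in> V \<and> y \<in> V \<and> x \<noteq> y"
  using edge_obtain[of "{x, y}"] by (auto simp: doubleton_eq_iff)

lemma edge_sym: "{x, y} \<in> E \<Longrightarrow> {y, x} \<in> E"
  by (simp add: insert_commute)

lemma finite_E: "finite E"
proof -
  have "E \<subseteq> Pow V" using edge_obtain by blast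
  then show ?thesis using finite_V finite_subset by blast
qed

lemma finite_nbrs: "finite {y. {x, y} \<in> E}"
  by (rule finite_subset[OF _ finite_V]) (auto dest: edgeD)

lemma degree_nbrs: "degree E x = card {y. {x, y} \<in> E}"
proof -
  have "e \<in> (\<lambda>y. {x, y}) ` {y. {x, y} \<in> E}" if e: "e \<in> E" "x \<in> e" for e
  proof -
    obtain a b where "e = {a, b}" using edge_obtain e(1) by blast
    then have "e = {x, a} \<or> e = {x, b}" using e(2) by auto
    then show ?thesis using e(1) by auto
  qed
  then have "{e \<in> E. x \<in> e} = (\<lambda>y. {x, y}) ` {y. {x, y} \<in> E}" by auto
  moreover have "inj_on (\<lambda>y. {x, y}) {y. {x, y} \<in> E}"
    by (auto intro!: inj_onI simp: doubleton_eq_iff)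
  ultimately show ?thesis by (simp add: degree_def card_image)
qed

lemma leaf_nbrs: "leaf E v \<Longrightarrow> \<exists>x. {y. {v, y} \<in> E} = {x}"
  by (auto simp: leaf_def degree_nbrs card_1_singleton_iff)

lemma leaf_nbr_unique:
  assumes "leaf E v" "{v, x} \<in> E" "{v, y} \<in> E"
  shows "x = y"
  using leaf_nbrs[OF assms(1)] assms(2,3) by (metis mem_Collect_eq singletonD)

lemma leaf_nbr: "leaf E v \<Longrightarrow> \<exists>x. {v, x} \<in> E"
  using leaf_nbrs by blast

lemma leaf_in_V: "leaf E v \<Longrightarrow> v \<in> V"
  using leaf_nbr edgeD by blast

lemma degree_ge:
  assumes "\<And>y. y \<in> N \<Longrightarrow> {x, y} \<in> E"
  shows "card N \<le> degree E x"
  unfolding degree_nbrs using assms finite_nbrs by (intro card_mono) auto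

lemma degree_pos: "{x, y} \<in> E \<Longrightarrow> 0 < degree E x"
  using degree_ge[of "{y}" x] by auto

lemma nbr_avoiding:
  assumes "card N < degree E x" "finite N"
  shows "\<exists>z. {x, z} \<in> E \<and> z \<notin> N"
proof (rule ccontr)
  assume "\<not> ?thesis"
  then have "{y. {x, y} \<in> E} \<subseteq> N" by auto
  then have "degree E x \<le> card N" unfolding degree_nbrs by (rule card_mono[OF assms(2)])
  then show False using assms(1) by simp
qed

lemma nonleaf_other_nbr:
  assumes "{x, y} \<in> E" "\<not> leaf E y"
  shows "\<exists>z. {y, z} \<in> E \<and> z \<noteq> x"
proof -
  have "0 < degree E y" using assms(1) edge_sym degree_pos by blast
  then have "card {x} < degree E y" using assms(2) by (simp add: leaf_def)
  then show ?thesis using nbr_avoiding[of "{x}" y] by auto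
qed

lemma degree2_nbr:
  assumes "degree E v \<le> 2" "{v, x} \<in> E" "{v, y} \<in> E" "x \<noteq> y" "{v, z} \<in> E"
  shows "z = x \<or> z = y"
proof (rule ccontr)
  assume "\<not> ?thesis"
  then have "card {x, y, z} = 3" using assms(4) by auto
  moreover have "card {x, y, z} \<le> degree E v" by (rule degree_ge) (use assms in auto)
  ultimately show False using assms(1) by simp
qed

lemma path_edge: "is_path V E p \<Longrightarrow> Suc i < length p \<Longrightarrow> {p ! i, p ! Suc i} \<in> E"
  by (simp add: is_path_def)

lemma leaf_on_path:
  assumes "is_path V E p" "i < length p" "leaf E (p ! i)"
  shows "i = 0 \<or> Suc i = length p"
proof (rule ccontr)
  assume "\<not> ?thesis"
  then obtain k where k: "i = Suc k" "Suc (Suc k) < length p" using assms(2) by (cases i) auto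
  have "p ! k = p ! Suc (Suc k)"
    using leaf_nbr_unique[OF assms(3)] path_edge[OF assms(1), of k] path_edge[OF assms(1), of "Suc k"] k
    by (auto simp: insert_commute)
  then show False using assms(1) k by (simp add: is_path_def nth_eq_iff_index_eq)
qed

lemma leaf_on_path_end:
  assumes "is_path V E p" "v \<in> set p" "leaf E v"
  shows "v = hd p \<or> v = last p"
proof -
  obtain i where i: "i < length p" "p ! i = v" using assms(2) by (auto simp: in_set_conv_nth)
  then have "i = 0 \<or> Suc i = length p" using leaf_on_path assms by auto
  moreover have "p \<noteq> []" using assms(2) by auto
  ultimately show ?thesis using i by (metis diff_Suc_1 hd_conv_nth last_conv_nth)
qed

end

section \<open>Bare paths\<close>

lemma is_bare_path_rev: "is_bare_path V E p \<Longrightarrow> is_bare_path V E (rev p)"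
proof -
  assume p: "is_bare_path V E p"
  have "degree E (rev p ! i) = 2" if "0 < i" "Suc i < length p" for i
  proof -
    have "0 < length p - Suc i" "Suc (length p - Suc i) < length p" using that by auto
    then show ?thesis using p that by (auto simp: is_bare_path_def rev_nth)
  qed
  then show ?thesis using p is_path_rev by (auto simp: is_bare_path_def hd_rev last_rev)
qed

lemma vertex_of_path_edges: "v \<in> e \<Longrightarrow> e \<in> path_edges p \<Longrightarrow> v \<in> set p"
  by (auto simp: path_edges_def)

lemma card_edges_at:
  assumes "distinct p" "\<And>i. i \<in> I \<Longrightarrow> Suc i < length p"
  shows "card ((\<lambda>i. {p ! i, p ! Suc i}) ` I) = card I"
  by (rule card_image, rule inj_onI) (use path_edges_idx_inj[OF assms(1)] assms(2) in blast)

lemma card_filter_sum: "finite A \<Longrightarrow> card {x \<in> A. P x} = (\<Sum>x\<in>A. if P x then 1 else 0)"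
  using sum.inter_filter[of A "\<lambda>_. 1::nat" P] by simp

text \<open>Degree at most two rather than exactly two, so that an edge from a leaf to a vertex of
  degree two is included. This is the additional edge that \<open>h2_star\<close> credits to a bare
  path containing a leaf.\<close>

definition low_edges :: "'a set set \<Rightarrow> 'a set set" where
  "low_edges E = {e \<in> E. \<forall>v\<in>e. degree E v \<le> 2}"

context sgraph
begin

text \<open>An inner vertex of a bare path has degree two, so after arriving along a given edge
  there is only one way on. \<open>q\<close> cannot stop before \<open>p\<close> does, because its
  end would have degree two.\<close>

lemma bare_path_forward:
  assumes p: "is_bare_path V E p" and q: "is_bare_path V E q"
    and ij: "Suc i < length p" "Suc j < length q" "p ! i = q ! j" "p ! Suc i = q ! Suc j"
  shows "Suc (i + k) < length p \<Longrightarrow>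
    Suc (j + k) < length q \<and> p ! (i + k) = q ! (j + k) \<and> p ! Suc (i + k) = q ! Suc (j + k)"
proof (induction k)
  case 0
  then show ?case using ij by simp
next
  case (Suc k)
  have P: "is_path V E p" and Q: "is_path V E q" using p q by (auto simp: is_bare_path_def)
  let ?v = "p ! Suc (i + k)"
  have IH: "Suc (j + k) < length q" "p ! (i + k) = q ! (j + k)" "?v = q ! Suc (j + k)"
    using Suc by auto
  have d: "degree E ?v = 2" using p Suc.prems by (auto simp: is_bare_path_def)
  have "Suc (Suc (j + k)) \<noteq> length q"
  proof
    assume "Suc (Suc (j + k)) = length q"
    then have "last q = ?v" using IH by (metis diff_Suc_1 last_conv_nth list.size(3) nat.distinct(1))
    then show False using d q by (auto simp: is_bare_path_def)
  qed
  then have l: "Suc (Suc (j + k)) < length q" using IH by auto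
  have e: "{?v, p ! (i + k)} \<in> E" "{?v, p ! Suc (Suc (i + k))} \<in> E"
    using path_edge[OF P, of "i + k"] path_edge[OF P, of "Suc (i + k)"] Suc.prems
    by (auto simp: insert_commute)
  have f: "{?v, q ! Suc (Suc (j + k))} \<in> E"
    using path_edge[OF Q, of "Suc (j + k)"] l IH by auto
  have "p ! (i + k) \<noteq> p ! Suc (Suc (i + k))"
    using P Suc.prems by (auto simp: is_path_def nth_eq_iff_index_eq)
  moreover have "q ! Suc (Suc (j + k)) \<noteq> p ! (i + k)"
    using Q l IH by (auto simp: is_path_def nth_eq_iff_index_eq)
  ultimately have "q ! Suc (Suc (j + k)) = p ! Suc (Suc (i + k))"
    using degree2_nbr[OF _ e(1) e(2) _ f] d by auto
  then show ?case using l IH by auto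
qed

lemma bare_path_forward_edges:
  assumes "is_bare_path V E p" "is_bare_path V E q"
    and "Suc i < length p" "Suc j < length q" "p ! i = q ! j" "p ! Suc i = q ! Suc j"
    and "i \<le> l" "Suc l < length p"
  shows "{p ! l, p ! Suc l} \<in> path_edges q"
  using bare_path_forward[OF assms(1-6), of "l - i"] assms(7,8) by (auto simp: path_edges_def)

lemma bare_path_oriented_edges:
  assumes p: "is_bare_path V E p" and q: "is_bare_path V E q"
    and ij: "Suc i < length p" "Suc j < length q" "p ! i = q ! j" "p ! Suc i = q ! Suc j"
  shows "path_edges p \<subseteq> path_edges q"
proof
  fix e assume "e \<in> path_edges p"
  then obtain l where l: "Suc l < length p" "e = {p ! l, p ! Suc l}" by (auto simp: path_edges_def)
  show "e \<in> path_edges q"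
  proof (cases "i \<le> l")
    case True
    then show ?thesis using bare_path_forward_edges[OF p q ij] l by auto
  next
    case False
    \<comment> \<open>In the reversed list the edge at position \<open>i\<close> sits at
      \<open>length p - Suc (Suc i)\<close> with its ends swapped. An edge before the common one now
      comes after it, so the forward lemma applies to the reversals.\<close>
    define i' j' l' where "i' = length p - Suc (Suc i)" and "j' = length q - Suc (Suc j)"
      and "l' = length p - Suc (Suc l)"
    have s: "length p - Suc i' = Suc i" "length p - Suc (Suc i') = i" "length q - Suc j' = Suc j"
      "length q - Suc (Suc j') = j" "length p - Suc l' = Suc l" "length p - Suc (Suc l') = l"
      "Suc i' < length p" "Suc j' < length q" "Suc l' < length p" "i' \<le> l'"
      using ij l False by (auto simp: i'_def j'_def l'_def)
    have "{rev p ! l', rev p ! Suc l'} \<in> path_edges (rev q)"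
      by (rule bare_path_forward_edges[OF is_bare_path_rev[OF p] is_bare_path_rev[OF q], of i' j'])
        (use s ij in \<open>auto simp: rev_nth\<close>)
    then show ?thesis using s l by (simp add: path_edges_rev rev_nth insert_commute)
  qed
qed

lemma bare_path_edges_subset:
  assumes p: "is_bare_path V E p" and q: "is_bare_path V E q"
    and e: "e \<in> path_edges p" "e \<in> path_edges q"
  shows "path_edges p \<subseteq> path_edges q"
proof -
  obtain i where i: "Suc i < length p" "e = {p ! i, p ! Suc i}" using e by (auto simp: path_edges_def)
  obtain j where j: "Suc j < length q" "e = {q ! j, q ! Suc j}" using e by (auto simp: path_edges_def)
  consider "p ! i = q ! j" "p ! Suc i = q ! Suc j" | "p ! i = q ! Suc j" "p ! Suc i = q ! j"
    using i j by (auto simp: doubleton_eq_iff)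
  then show ?thesis
  proof cases
    case 1
    then show ?thesis using bare_path_oriented_edges[OF p q] i j by auto
  next
    case 2
    define j' where "j' = length q - Suc (Suc j)"
    have s: "length q - Suc j' = Suc j" "length q - Suc (Suc j') = j" "Suc j' < length q"
      using j by (auto simp: j'_def)
    have "path_edges p \<subseteq> path_edges (rev q)"
      by (rule bare_path_oriented_edges[OF p is_bare_path_rev[OF q], of i j'])
        (use s 2 i in \<open>auto simp: rev_nth\<close>)
    then show ?thesis by (simp add: path_edges_rev)
  qed
qed

text \<open>Distinct members of \<open>bare_paths\<close> are hence disjoint, which allows edges to
  be counted one bare path at a time.\<close>

lemma bare_path_edges_eq:
  assumes "is_bare_path V E p" "is_bare_path V E q" "e \<in> path_edges p" "e \<in> path_edges q"
  shows "path_edges p = path_edges q"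
  using bare_path_edges_subset assms by blast

lemma finite_bare_paths: "finite (bare_paths V E)"
proof -
  have "bare_paths V E \<subseteq> Pow E"
    by (auto simp: bare_paths_def is_bare_path_def dest: path_edges_subset)
  then show ?thesis using finite_E finite_subset by blast
qed

lemma low_edges_of_bare_path:
  assumes p: "is_bare_path V E p" and I: "\<And>i. i \<in> I \<Longrightarrow> Suc i < length p"
    and low: "\<And>i. i \<in> I \<Longrightarrow> degree E (p ! i) \<le> 2 \<and> degree E (p ! Suc i) \<le> 2"
  shows "card I \<le> card (path_edges p \<inter> low_edges E)"
proof -
  have P: "is_path V E p" "distinct p" using p by (auto simp: is_bare_path_def is_path_def)
  have "card I = card ((\<lambda>i. {p ! i, p ! Suc i}) ` I)" using card_edges_at[OF P(2) I] by simp
  also have "\<dots> \<le> card (path_edges p \<inter> low_edges E)"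
  proof (rule card_mono)
    show "(\<lambda>i. {p ! i, p ! Suc i}) ` I \<subseteq> path_edges p \<inter> low_edges E"
      using I low path_edges_subset[OF P(1)] by (auto simp: low_edges_def path_edges_def)
  qed (simp add: finite_path_edges)
  finally show ?thesis .
qed

lemma bare_path_internal_degree:
  assumes "is_bare_path V E p" "0 < i" "Suc i < length p"
  shows "degree E (p ! i) = 2"
  using assms by (auto simp: is_bare_path_def)

text \<open>Starting from a leaf, only the far end of the last edge can have degree above
  two.\<close>

lemma low_edges_of_leaf_bare_path:
  assumes p: "is_bare_path V E p" and "leaf E (hd p)"
  shows "card (path_edges p) - 1 \<le> card (path_edges p \<inter> low_edges E)"
proof -
  have "degree E (p ! 0) = 1" "2 \<le> length p" "distinct p"
    using assms by (auto simp: is_bare_path_def leaf_def hd_conv_nth is_path_def)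
  moreover have "degree E (p ! i) \<le> 2" if "Suc i < length p" for i
    using bare_path_internal_degree[OF p _ that] \<open>degree E (p ! 0) = 1\<close> by (cases i) auto
  moreover have "Suc i < length p \<and> Suc (Suc i) < length p" if "i < length p - 2" for i
    using that by auto
  ultimately show ?thesis
    using low_edges_of_bare_path[OF p, of "{..<length p - 2}"] by (simp add: card_path_edges)
qed

text \<open>A long inner bare path may lose its two end edges and a bare path with a leaf only one,
  in agreement with the two sums of \<open>h2_star\<close>. Since bare paths share no edges, the
  contributions add up.\<close>

lemma h2_star_le_low_edges: "h2_star V E \<le> card (low_edges E)"
proof -
  let ?I = "long_inner_bare_paths V E" and ?B = "bare_paths V E"
  have long: "card P - 2 \<le> card (P \<inter> low_edges E)" if P: "P \<in> ?B" for P
  proof -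
    obtain p where p: "is_bare_path V E p" "P = path_edges p"
      using P unfolding bare_paths_def by blast
    then have "distinct p" by (auto simp: is_bare_path_def is_path_def)
    moreover have "card {1..<length p - 2} \<le> card (P \<inter> low_edges E)"
      unfolding p(2)
    proof (rule low_edges_of_bare_path[OF p(1)])
      fix i assume "i \<in> {1..<length p - 2}"
      then have "0 < i" "Suc (Suc i) < length p" by auto
      then show "Suc i < length p" "degree E (p ! i) \<le> 2 \<and> degree E (p ! Suc i) \<le> 2"
        using bare_path_internal_degree[OF p(1), of i] bare_path_internal_degree[OF p(1), of "Suc i"]
        by auto
    qed
    ultimately show ?thesis by (simp add: p(2) card_path_edges)
  qed
  have short: "card P - 1 \<le> card (P \<inter> low_edges E)" if P: "P \<in> ?B - ?I" for P
  \<comment> \<open>A single edge contributes zero. A longer bare path can be outside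
    \<open>?I\<close> only because it contains a leaf, and that leaf must be one of its
    ends.\<close>
  proof (cases "card P < 2")
    case False
    then obtain v e where v: "leaf E v" "v \<in> e" "e \<in> P"
      using P by (auto simp: long_inner_bare_paths_def)
    obtain p where p: "is_bare_path V E p" "P = path_edges p"
      using P unfolding bare_paths_def by blast
    have "v = hd p \<or> v = last p"
      using leaf_on_path_end[of p v] p v vertex_of_path_edges by (metis is_bare_path_def)
    then show ?thesis
      using low_edges_of_leaf_bare_path[OF p(1)] low_edges_of_leaf_bare_path[OF is_bare_path_rev[OF p(1)]]
        p(2) v(1) by (auto simp: path_edges_rev hd_rev)
  qed auto
  have "h2_star V E \<le> (\<Sum>P\<in>?B - ?I. card (P \<inter> low_edges E)) + (\<Sum>P\<in>?I. card (P \<inter> low_edges E))"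
    unfolding h2_star_def using long short
    by (intro add_mono sum_mono) (auto simp: long_inner_bare_paths_def)
  also have "\<dots> = (\<Sum>P\<in>?B. card (P \<inter> low_edges E))"
    by (rule sum.subset_diff[symmetric]) (auto simp: long_inner_bare_paths_def finite_bare_paths)
  also have "\<dots> = card (\<Union>P\<in>?B. P \<inter> low_edges E)"
  proof (rule card_UN_disjoint[symmetric])
    show "\<forall>P\<in>?B. finite (P \<inter> low_edges E)"
      by (auto simp: bare_paths_def finite_path_edges)
    show "\<forall>P\<in>?B. \<forall>Q\<in>?B. P \<noteq> Q \<longrightarrow> P \<inter> low_edges E \<inter> (Q \<inter> low_edges E) = {}"
      using bare_path_edges_eq by (fastforce simp: bare_paths_def)
  qed (rule finite_bare_paths)
  also have "\<dots> \<le> card (low_edges E)"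
    using finite_E by (intro card_mono) (auto simp: low_edges_def)
  finally show ?thesis .
qed

section \<open>The lower bound\<close>

text \<open>In a separating family every edge of \<open>low_edges\<close> is cut by some member, so
  this is the demand of the degree-two vertices charged to one path.\<close>

definition cut_edges :: "'a list \<Rightarrow> 'a set set" where
  "cut_edges p = {{x, y} | x y. {x, y} \<in> low_edges E \<and> x \<in> set p \<and> y \<notin> set p}"

definition exits :: "'a list \<Rightarrow> 'a \<Rightarrow> 'a set" where
  "exits p x = {y. {x, y} \<in> low_edges E \<and> y \<notin> set p}"

lemma finite_exits: "finite (exits p x)"
  by (rule finite_subset[OF _ finite_nbrs[of x]]) (auto simp: exits_def low_edges_def)

text \<open>Everything is charged to the ends of the path. If the path has an edge, an end already
  spends one unit of its degree on it, so an end is either a leaf or has at most one low edge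
  leaving the path. On a one-vertex path the set \<open>{hd p, last p}\<close> collapses, and its
  only vertex may use both units.\<close>

lemma path_exits:
  assumes p: "is_path V E p"
  shows "card {v \<in> set p. leaf E v} + card (cut_edges p) \<le> 2"
proof -
  define w where "w x = (if leaf E x then 1 else 0) + card (exits p x)" for x
  have ne: "p \<noteq> []" and dist: "distinct p" using p by (auto simp: is_path_def)
  \<comment> \<open>An inner vertex has two neighbours on the path; a low edge leaving the path
    there would be a third edge at a vertex of degree at most two.\<close>
  have ends: "x \<in> {hd p, last p}" if x: "x \<in> set p" "exits p x \<noteq> {}" for x
  proof (rule ccontr)
    assume n: "x \<notin> {hd p, last p}"
    obtain y where y: "{x, y} \<in> E" "degree E x \<le> 2" "y \<notin> set p"
      using x by (auto simp: exits_def low_edges_def)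
    obtain i where i: "i < length p" "x = p ! i" using x(1) by (auto simp: in_set_conv_nth)
    have "i \<noteq> 0" using n i ne by (metis hd_conv_nth insertI1)
    moreover have "Suc i \<noteq> length p" using n i ne by (metis diff_Suc_1 insertI1 insert_commute last_conv_nth)
    ultimately obtain k where k: "i = Suc k" "Suc (Suc k) < length p" using i by (cases i) auto
    have "{x, p ! k} \<in> E" "{x, p ! Suc (Suc k)} \<in> E"
      using path_edge[OF p, of k] path_edge[OF p, of "Suc k"] i k by (auto simp: insert_commute)
    moreover have "p ! k \<noteq> p ! Suc (Suc k)" using dist k by (auto simp: nth_eq_iff_index_eq)
    ultimately have "y = p ! k \<or> y = p ! Suc (Suc k)" using degree2_nbr y by blast
    then show False using y(3) k by auto
  qed
  have "card {v \<in> set p. leaf E v} \<le> card {v \<in> {hd p, last p}. leaf E v}"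
    using leaf_on_path_end[OF p] by (intro card_mono) auto
  also have "\<dots> = (\<Sum>x\<in>{hd p, last p}. if leaf E x then 1 else 0)"
    by (rule card_filter_sum) simp
  finally have leaves: "card {v \<in> set p. leaf E v} \<le> \<dots>" .
  have "cut_edges p \<subseteq> (\<Union>x\<in>{hd p, last p}. (\<lambda>y. {x, y}) ` exits p x)"
    using ends by (fastforce simp: cut_edges_def exits_def)
  then have "card (cut_edges p) \<le> card (\<Union>x\<in>{hd p, last p}. (\<lambda>y. {x, y}) ` exits p x)"
    by (intro card_mono) (auto simp: finite_exits)
  also have "\<dots> \<le> (\<Sum>x\<in>{hd p, last p}. card ((\<lambda>y. {x, y}) ` exits p x))"
    by (rule card_UN_le) auto
  also have "\<dots> \<le> (\<Sum>x\<in>{hd p, last p}. card (exits p x))"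
    by (intro sum_mono card_image_le finite_exits)
  finally have "card {v \<in> set p. leaf E v} + card (cut_edges p) \<le> (\<Sum>x\<in>{hd p, last p}. w x)"
    using leaves by (simp add: w_def sum.distrib)
  also have "\<dots> \<le> 2"
  proof (cases "length p = 1")
    case True
    then have "last p = hd p" by (metis One_nat_def diff_Suc_1 hd_conv_nth last_conv_nth ne)
    moreover have "w x \<le> 2" for x
    proof (cases "degree E x \<le> 2")
      case True
      have "card (exits p x) \<le> degree E x" by (rule degree_ge) (auto simp: exits_def low_edges_def)
      then show ?thesis using True by (auto simp: w_def leaf_def)
    next
      case False
      then have "exits p x = {}" by (auto simp: exits_def low_edges_def)
      then show ?thesis using False by (auto simp: w_def leaf_def)
    qed
    ultimately show ?thesis by simp
  next
    case False
    have w1: "w x \<le> 1" if z: "{x, z} \<in> E" "z \<in> set p" for x z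
    proof (cases "degree E x \<le> 2")
      case True
      have "card (insert z (exits p x)) \<le> degree E x"
        using z by (intro degree_ge) (auto simp: exits_def low_edges_def)
      moreover have "z \<notin> exits p x" using z by (auto simp: exits_def)
      ultimately show ?thesis using True finite_exits by (auto simp: w_def leaf_def)
    next
      case False
      then have "exits p x = {}" by (auto simp: exits_def low_edges_def)
      then show ?thesis using False by (auto simp: w_def leaf_def)
    qed
    obtain n where n: "length p = Suc (Suc n)" using False ne by (cases p; cases "tl p") auto
    have "{hd p, p ! 1} \<in> E" using path_edge[OF p, of 0] n ne by (simp add: hd_conv_nth)
    then have "w (hd p) \<le> 1" using w1 n by simp
    moreover have "{last p, p ! n} \<in> E"
      using path_edge[OF p, of n] n ne by (simp add: last_conv_nth insert_commute)
    then have "w (last p) \<le> 1" using w1 n by simp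
    ultimately show ?thesis by (cases "hd p = last p") auto
  qed
  finally show ?thesis .
qed

text \<open>Summing \<open>path_exits\<close> over the family and counting incidences of leaves with
  paths gives \<open>main\<close>. Each leaf accounts for at least one incidence, and for at least
  two unless it is in \<open>L1\<close>, which has at most \<open>card F\<close> members.\<close>

lemma family_lower_bounds:
  assumes F: "finite F" "\<And>p. p \<in> F \<Longrightarrow> is_path V E p"
    and sep: "separates F (Vertex ` V)" and cov: "covers F (Vertex ` V)"
  shows "2 * h1 V E + h2_star V E \<le> 3 * card F" "h1 V E + h2_star V E \<le> 2 * card F"
proof -
  define L where "L = {v \<in> V. leaf E v}"
  define T where "T v = {p \<in> F. v \<in> set p}" for v
  have T: "paths_through F (Vertex v) = T v" for v by (simp add: T_def paths_through_def)
  have fL: "finite L" using finite_V by (simp add: L_def)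
  have fT: "finite (T v)" for v using F(1) by (simp add: T_def)
  have inj: "T u = T v \<Longrightarrow> u = v" if "u \<in> V" "v \<in> V" for u v
    using sep that by (auto simp: separates_def T)
  have pos: "card (T v) \<ge> 1" if "v \<in> L" for v
    using cov that fT[of v] by (auto simp: covers_def T L_def Suc_le_eq card_gt_0_iff)
  have low: "card (low_edges E) \<le> (\<Sum>p\<in>F. card (cut_edges p))"
  proof -
    have fc: "finite (cut_edges p)" for p
      by (rule finite_subset[OF _ finite_E]) (auto simp: cut_edges_def low_edges_def)
    have "low_edges E \<subseteq> (\<Union>p\<in>F. cut_edges p)"
    proof
      fix e assume e: "e \<in> low_edges E"
      then obtain x y where xy: "e = {x, y}" "x \<in> V" "y \<in> V" "x \<noteq> y"
        using edge_obtain[of e] by (auto simp: low_edges_def)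
      then have "T x \<noteq> T y" using inj by blast
      then obtain p where "p \<in> F" "(x \<in> set p) \<noteq> (y \<in> set p)" by (auto simp: T_def)
      then show "e \<in> (\<Union>p\<in>F. cut_edges p)"
        using e xy(1) by (auto simp: cut_edges_def insert_commute)
    qed
    then have "card (low_edges E) \<le> card (\<Union>p\<in>F. cut_edges p)"
      by (intro card_mono) (auto simp: F(1) fc)
    also have "\<dots> \<le> (\<Sum>p\<in>F. card (cut_edges p))" by (rule card_UN_le[OF F(1)])
    finally show ?thesis .
  qed
  have "(\<Sum>v\<in>L. card (T v)) = (\<Sum>p\<in>F. card {v \<in> L. v \<in> set p})"
    unfolding T_def by (rule sum_multicount_gen[OF fL F(1)]) auto
  also have "\<dots> = (\<Sum>p\<in>F. card {v \<in> set p. leaf E v})"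
    using F(2) by (intro sum.cong refl arg_cong[of _ _ card]) (auto simp: L_def is_path_def)
  finally have leaves: "(\<Sum>v\<in>L. card (T v)) = \<dots>" .
  have "(\<Sum>v\<in>L. card (T v)) + (\<Sum>p\<in>F. card (cut_edges p)) \<le> (\<Sum>p\<in>F. 2)"
    unfolding leaves sum.distrib[symmetric] using path_exits F(2) by (intro sum_mono) auto
  then have main: "(\<Sum>v\<in>L. card (T v)) + h2_star V E \<le> 2 * card F"
    using low h2_star_le_low_edges by simp
  have "(\<Sum>v\<in>L. 1) \<le> (\<Sum>v\<in>L. card (T v))" using pos by (intro sum_mono) auto
  then show "h1 V E + h2_star V E \<le> 2 * card F" using main by (simp add: h1_def L_def)
  define L1 where "L1 = {v \<in> L. card (T v) = 1}"
  \<comment> \<open>Separation makes \<open>T\<close> injective on vertices, and on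
    \<open>L1\<close> its values are singletons of members of \<open>F\<close>.\<close>
  have "card L1 \<le> card F"
  proof -
    have "card L1 = card (T ` L1)"
      by (rule card_image[symmetric], rule inj_onI) (use inj in \<open>auto simp: L1_def L_def\<close>)
    also have "\<dots> \<le> card ((\<lambda>p. {p}) ` F)"
    proof (rule card_mono)
      show "T ` L1 \<subseteq> (\<lambda>p. {p}) ` F"
      proof
        fix X assume "X \<in> T ` L1"
        then obtain v where "X = T v" "card (T v) = 1" by (auto simp: L1_def)
        then obtain p where "X = {p}" by (auto simp: card_1_singleton_iff)
        moreover have "X \<subseteq> F" using \<open>X = T v\<close> by (auto simp: T_def)
        ultimately show "X \<in> (\<lambda>p. {p}) ` F" by auto
      qed
    qed (simp add: F(1))
    also have "\<dots> \<le> card F" by (rule card_image_le[OF F(1)])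
    finally show ?thesis .
  qed
  moreover have "2 * card L \<le> (\<Sum>v\<in>L. card (T v)) + card L1"
  proof -
    have "2 * card L = (\<Sum>v\<in>L. 2)" by simp
    also have "\<dots> \<le> (\<Sum>v\<in>L. card (T v) + (if card (T v) = 1 then 1 else 0))"
    proof (rule sum_mono)
      fix v assume "v \<in> L"
      then show "2 \<le> card (T v) + (if card (T v) = 1 then 1 else 0)" using pos[of v] by auto
    qed
    also have "\<dots> = (\<Sum>v\<in>L. card (T v)) + card L1"
      unfolding sum.distrib L1_def card_filter_sum[OF fL] ..
    finally show ?thesis .
  qed
  ultimately show "2 * h1 V E + h2_star V E \<le> 3 * card F" using main by (simp add: h1_def L_def)
qed

lemma sp_star_lower_bounds:
  shows "2 * h1 V E + h2_star V E \<le> 3 * sp_star V E (Vertex ` V)"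
    "h1 V E + h2_star V E \<le> 2 * sp_star V E (Vertex ` V)"
proof -
  let ?P = "\<lambda>k. \<exists>F. finite F \<and> card F = k \<and> (\<forall>p\<in>F. is_path V E p) \<and>
     separates F (Vertex ` V) \<and> covers F (Vertex ` V)"
  \<comment> \<open>The minimum in \<open>sp_star\<close> is attained only if some family qualifies;
    the one-vertex paths do.\<close>
  let ?F = "(\<lambda>v. [v]) ` V"
  have "finite ?F" "\<forall>p\<in>?F. is_path V E p" using finite_V by (auto simp: is_path_def)
  moreover have "separates ?F (Vertex ` V)"
  proof -
    have "paths_through ?F (Vertex v) = {[v]}" if "v \<in> V" for v
      using that by (auto simp: paths_through_def)
    then show ?thesis by (auto simp: separates_def)
  qed
  moreover have "covers ?F (Vertex ` V)"
    by (auto simp: covers_def paths_through_def)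
  ultimately have "?P (card ?F)" by blast
  then have "?P (sp_star V E (Vertex ` V))" unfolding sp_star_def by (rule LeastI)
  then obtain F where "finite F" "card F = sp_star V E (Vertex ` V)" "\<forall>p\<in>F. is_path V E p"
    "separates F (Vertex ` V)" "covers F (Vertex ` V)"
    by blast
  then show "2 * h1 V E + h2_star V E \<le> 3 * sp_star V E (Vertex ` V)"
    "h1 V E + h2_star V E \<le> 2 * sp_star V E (Vertex ` V)"
    using family_lower_bounds[of F] by auto
qed

end

section \<open>Branches of a tree\<close>

locale tree =
  fixes V :: "'a set" and E :: "'a set set"
  assumes tree: "is_tree V E"
begin

sublocale sgraph
  using tree by unfold_locales (simp add: is_tree_def)

lemma no_cycle: "\<not> is_cycle V E c"
  using tree by (auto simp: is_tree_def)

lemma all_joined: "u \<in> V \<Longrightarrow> v \<in> V \<Longrightarrow> joined V E u v"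
  using tree by (auto simp: is_tree_def)

text \<open>The component of \<open>y\<close> after deletion of the edge, that is, the part of the
  tree beyond \<open>{x, y}\<close> as seen from \<open>x\<close>. Later arguments about paths and
  cyclic orders reduce to the question on which side of an edge a vertex lies.\<close>

definition branch :: "'a \<Rightarrow> 'a \<Rightarrow> 'a set" where
  "branch x y = {v \<in> V. joined V (E - {{x, y}}) v y}"

lemma branch_in_V: "v \<in> branch x y \<Longrightarrow> v \<in> V"
  by (simp add: branch_def)

lemma finite_branch: "finite (branch x y)"
  using finite_V by (simp add: branch_def)

lemma target_in_branch: "{x, y} \<in> E \<Longrightarrow> y \<in> branch x y"
  using edgeD by (auto simp: branch_def joined_refl)

text \<open>Acyclicity enters here: a path from \<open>x\<close> to \<open>y\<close> that avoids the
  edge would close up with it to a cycle.\<close>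

lemma source_notin_branch:
  assumes e: "{x, y} \<in> E"
  shows "x \<notin> branch x y"
proof
  assume "x \<in> branch x y"
  then obtain p where p: "is_path V (E - {{x, y}}) p" "hd p = x" "last p = y"
    by (auto simp: branch_def joined_def)
  have ne: "p \<noteq> []" "x \<noteq> y" using p e edgeD by (auto simp: is_path_def)
  have "length p \<noteq> 1"
    using ne p(2,3) by (auto simp: length_Suc_conv)
  moreover have "length p \<noteq> 2"
  proof
    assume l: "length p = 2"
    then have "{p ! 0, p ! 1} \<noteq> {x, y}" using p(1) by (auto simp: is_path_def)
    moreover have "p ! 0 = x" "p ! 1 = y" using p(2,3) ne l by (auto simp: hd_conv_nth last_conv_nth)
    ultimately show False by simp
  qed
  moreover have "length p \<noteq> 0" using ne by simp
  ultimately have "3 \<le> length p" by linarith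
  moreover have "is_path V E p" using is_path_mono[OF p(1)] by blast
  ultimately show False using no_cycle[of p] e p by (auto simp: is_cycle_def insert_commute)
qed

text \<open>Every other edge survives the deletion and therefore keeps both its ends on one
  side.\<close>

lemma branch_edge:
  assumes e: "{x, y} \<in> E" and ab: "{a, b} \<in> E" "a \<in> branch x y" "b \<notin> branch x y"
  shows "a = y \<and> b = x"
proof -
  have V: "a \<in> V" "b \<in> V" using edgeD ab by auto
  have "{a, b} = {x, y}"
  proof (rule ccontr)
    assume "{a, b} \<noteq> {x, y}"
    then have "joined V (E - {{x, y}}) b a"
      using ab V by (intro joined_edge) (auto simp: insert_commute)
    then show False using joined_trans[of V _ b a y] ab V by (auto simp: branch_def)
  qed
  then show ?thesis using source_notin_branch[OF e] ab by (auto simp: doubleton_eq_iff)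
qed

text \<open>Walking from \<open>x\<close> to \<open>v\<close>, the side can change only along the
  edge itself, and then to the opposite branch.\<close>

lemma branch_cover:
  assumes e: "{x, y} \<in> E" and v: "v \<in> V" "v \<notin> branch x y"
  shows "v \<in> branch y x"
proof -
  have V: "x \<in> V" "y \<in> V" using edgeD e by auto
  have "v \<in> branch x y \<or> v \<in> branch y x"
    using all_joined[OF V(1) v(1)]
  proof (rule joined_induct)
    show "x \<in> branch x y \<or> x \<in> branch y x" using target_in_branch e edge_sym by blast
  next
    fix a b assume a: "a \<in> branch x y \<or> a \<in> branch y x" "a \<in> V" "b \<in> V" "{a, b} \<in> E"
    show "b \<in> branch x y \<or> b \<in> branch y x"
    proof (cases "{a, b} = {x, y}")
      case True
      then show ?thesis
        using target_in_branch[OF e] target_in_branch[OF edge_sym[OF e]] by (auto simp: doubleton_eq_iff)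
    next
      case False
      then show ?thesis
        using branch_edge[OF e a(4)] branch_edge[OF edge_sym[OF e] a(4)] a(1)
        by (auto simp: doubleton_eq_iff)
    qed
  qed
  then show ?thesis using v by simp
qed

lemma branch_opposite:
  assumes e: "{x, y} \<in> E"
  shows "branch y x = V - branch x y"
proof -
  have "v \<notin> branch y x" if "v \<in> branch x y" for v
  proof
    assume "v \<in> branch y x"
    then have "joined V (E - {{x, y}}) x y"
      using that joined_sym joined_trans by (fastforce simp: branch_def insert_commute)
    then show False using source_notin_branch[OF e] joined_in by (fastforce simp: branch_def)
  qed
  then show ?thesis using branch_cover[OF e] branch_in_V by blast
qed

lemma path_leaves_branch:
  assumes e: "{x, y} \<in> E" and p: "is_path V E p"
    and ij: "i \<le> j" "j < length p" "p ! i \<in> branch x y" "p ! j \<notin> branch x y"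
  obtains k where "i \<le> k" "k < j" "p ! k = y" "p ! Suc k = x"
proof -
  obtain k where k: "i \<le> k" "k < j" "p ! k \<in> branch x y" "p ! Suc k \<notin> branch x y"
    using path_change[of i j "\<lambda>v. v \<in> branch x y" p] ij by auto
  then have "{p ! k, p ! Suc k} \<in> E" using path_edge[OF p] ij(2) by auto
  then show ?thesis using branch_edge[OF e] k that by blast
qed

lemma path_enters_branch:
  assumes e: "{x, y} \<in> E" and p: "is_path V E p"
    and ij: "i \<le> j" "j < length p" "p ! i \<notin> branch x y" "p ! j \<in> branch x y"
  obtains k where "i \<le> k" "k < j" "p ! k = x" "p ! Suc k = y"
proof -
  have "p ! i \<in> V" "p ! j \<in> V" using p ij(1,2) by (auto simp: is_path_def)
  then have "p ! i \<in> branch y x" "p ! j \<notin> branch y x"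
    using ij branch_opposite[OF e] by auto
  then show ?thesis using path_leaves_branch[OF edge_sym[OF e] p ij(1,2)] that by blast
qed

lemma path_crosses_edge:
  assumes e: "{x, y} \<in> E" and p: "is_path V E p"
    and ab: "a \<in> set p" "b \<in> set p" "a \<in> branch x y" "b \<notin> branch x y"
  shows "x \<in> set p \<and> y \<in> set p"
proof -
  obtain i j where ij: "i < length p" "p ! i = a" "j < length p" "p ! j = b"
    using ab by (auto simp: in_set_conv_nth)
  show ?thesis
  proof (cases "i \<le> j")
    case True
    then obtain k where "k < j" "p ! k = y" "p ! Suc k = x"
      using path_leaves_branch[OF e p, of i j] ij ab by auto
    then show ?thesis using ij(3) by (metis Suc_lessI Suc_lessD less_trans_Suc nth_mem)
  next
    case False
    then obtain k where "k < i" "p ! k = x" "p ! Suc k = y"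
      using path_enters_branch[OF e p, of j i] ij ab by auto
    then show ?thesis using ij(1) by (metis Suc_lessI Suc_lessD less_trans_Suc nth_mem)
  qed
qed

text \<open>Entering the branch and leaving it again both pass through \<open>x\<close>, at two
  different positions, which a path cannot do.\<close>

lemma path_avoids_branch:
  assumes e: "{x, y} \<in> E" and p: "is_path V E p"
    and ends: "hd p \<notin> branch x y" "last p \<notin> branch x y" and v: "v \<in> set p"
  shows "v \<notin> branch x y"
proof
  assume b: "v \<in> branch x y"
  obtain i where i: "i < length p" "p ! i = v" using v by (auto simp: in_set_conv_nth)
  have ne: "p \<noteq> []" and dist: "distinct p" using p by (auto simp: is_path_def)
  obtain k where k: "k < i" "p ! k = x"
    using path_enters_branch[OF e p, of 0 i] i b ends ne by (auto simp: hd_conv_nth)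
  obtain l where l: "i \<le> l" "l < length p - 1" "p ! Suc l = x"
  proof (rule path_leaves_branch[OF e p, of i "length p - 1"])
    show "i \<le> length p - 1" "length p - 1 < length p" using i by auto
    show "p ! i \<in> branch x y" "p ! (length p - 1) \<notin> branch x y"
      using i b ends ne by (auto simp: last_conv_nth)
  qed blast
  have "Suc l < length p" "k < length p" using k l i by auto
  then have "k = Suc l" using dist k(2) l(3) nth_eq_iff_index_eq by metis
  then show False using k(1) l(1) by simp
qed

lemma path_within_branch:
  assumes e: "{x, y} \<in> E" and p: "is_path V E p"
    and ends: "hd p \<in> branch x y" "last p \<in> branch x y" and v: "v \<in> set p"
  shows "v \<in> branch x y"
proof -
  have "v \<in> V" using p v by (auto simp: is_path_def)
  then show ?thesis
    using path_avoids_branch[OF edge_sym[OF e] p _ _ v] ends branch_opposite[OF e] by auto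
qed

lemma path_in_one_branch:
  assumes e: "{x, y} \<in> E" and p: "is_path V E p" and "x \<notin> set p" "a \<in> set p" "b \<in> set p"
    and "a \<in> branch x y"
  shows "b \<in> branch x y"
  using path_crosses_edge[OF e p, of a b] assms by blast

section \<open>Tree paths and the branches at one vertex\<close>

definition tpath :: "'a \<Rightarrow> 'a \<Rightarrow> 'a list" where
  "tpath u v = (SOME p. is_path V E p \<and> hd p = u \<and> last p = v)"

lemma tpath:
  assumes "u \<in> V" "v \<in> V"
  shows "is_path V E (tpath u v)" "hd (tpath u v) = u" "last (tpath u v) = v"
    "u \<in> set (tpath u v)" "v \<in> set (tpath u v)"
proof -
  have "is_path V E (tpath u v) \<and> hd (tpath u v) = u \<and> last (tpath u v) = v"
    unfolding tpath_def by (rule someI_ex) (use all_joined[OF assms] in \<open>simp add: joined_def\<close>)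
  moreover from this have "tpath u v \<noteq> []" by (auto simp: is_path_def)
  ultimately show "is_path V E (tpath u v)" "hd (tpath u v) = u" "last (tpath u v) = v"
    "u \<in> set (tpath u v)" "v \<in> set (tpath u v)"
    using hd_in_set last_in_set by metis+
qed

text \<open>A path from \<open>v\<close> to \<open>x\<close> has to leave the branch through its
  root, so that root is the vertex just before \<open>x\<close> on the path. This determines
  it.\<close>

lemma branch_disjoint:
  assumes e: "{x, y} \<in> E" "{x, y'} \<in> E" and v: "v \<in> branch x y" "v \<in> branch x y'"
  shows "y = y'"
proof -
  have x: "x \<in> V" "v \<in> V" using edgeD e(1) v branch_in_V by auto
  let ?p = "tpath v x"
  note p = tpath[OF x(2,1)]
  have ne: "?p \<noteq> []" and dist: "distinct ?p" using p(1) by (auto simp: is_path_def)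
  have *: "?p ! (length ?p - 2) = z" if z: "{x, z} \<in> E" "v \<in> branch x z" for z
  proof -
    have "?p ! 0 = v" "?p ! (length ?p - 1) = x"
      using p(2,3) ne by (simp_all add: hd_conv_nth last_conv_nth)
    then obtain k where k: "k < length ?p - 1" "?p ! k = z" "?p ! Suc k = x"
      using path_leaves_branch[OF z(1) p(1), of 0 "length ?p - 1"] source_notin_branch[OF z(1)] z(2) ne
      by auto
    then have "Suc k = length ?p - 1"
      using dist \<open>?p ! (length ?p - 1) = x\<close> nth_eq_iff_index_eq[of ?p "Suc k" "length ?p - 1"] by auto
    then have "k = length ?p - 2" by simp
    then show ?thesis using k by simp
  qed
  show ?thesis using *[OF e(1) v(1)] *[OF e(2) v(2)] by simp
qed

lemma branch_exists:
  assumes "x \<in> V" "v \<in> V" "v \<noteq> x"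
  obtains y where "{x, y} \<in> E" "v \<in> branch x y"
proof -
  let ?p = "tpath v x"
  note p = tpath[OF assms(2,1)]
  have ne: "?p \<noteq> []" and dist: "distinct ?p" using p(1) by (auto simp: is_path_def)
  have l: "?p ! 0 = v" "?p ! (length ?p - 1) = x"
    using p(2,3) ne by (simp_all add: hd_conv_nth last_conv_nth)
  then have "length ?p - 1 \<noteq> 0" using assms(3) by metis
  then obtain n where n: "length ?p = Suc (Suc n)"
    by (metis One_nat_def Suc_pred diff_Suc_1 length_greater_0_conv ne not_gr_zero)
  define y where "y = ?p ! n"
  have e: "{x, y} \<in> E" using path_edge[OF p(1), of n] n l y_def by (auto simp: insert_commute)
  have "v \<in> branch x y"
  proof (rule ccontr)
    assume "v \<notin> branch x y"
    then obtain k where "k < n" "?p ! k = x"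
      using path_enters_branch[OF e p(1), of 0 n] l n target_in_branch[OF e] y_def by auto
    then show False using dist l n nth_eq_iff_index_eq[of ?p k "Suc n"] by auto
  qed
  then show ?thesis using that e by blast
qed

text \<open>A path inside \<open>branch x g\<close> avoids \<open>u\<close>, so it cannot cross the
  edge \<open>{u, y}\<close>; all of it lies on the same side as \<open>g\<close>.\<close>

lemma branch_subset:
  assumes e: "{x, g} \<in> E" "{u, y} \<in> E" and "u \<notin> branch x g" "g \<in> branch u y"
  shows "branch x g \<subseteq> branch u y"
proof
  fix v assume v: "v \<in> branch x g"
  have V: "v \<in> V" "g \<in> V" using v branch_in_V edgeD e by auto
  note p = tpath[OF V]
  have "u \<notin> set (tpath v g)"
    using path_within_branch[OF e(1) p(1)] p v target_in_branch[OF e(1)] assms(3) by auto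
  then show "v \<in> branch u y" using path_in_one_branch[OF e(2) p(1) _ p(5,4)] assms(4) by blast
qed

lemma branch_subset_beyond:
  assumes "{x, y} \<in> E" "{y, z} \<in> E" "z \<noteq> x"
  shows "branch y z \<subseteq> branch x y"
proof -
  have "x \<in> branch y x" using target_in_branch assms(1) edge_sym by blast
  then have "x \<notin> branch y z" using branch_disjoint[OF edge_sym[OF assms(1)] assms(2)] assms(3) by blast
  moreover have "z \<in> branch x y"
    using branch_edge[OF assms(1,2) target_in_branch[OF assms(1)]] assms(3) by blast
  ultimately show ?thesis using branch_subset assms by blast
qed

definition supports :: "'a set" where
  "supports = {w. \<exists>l. leaf E l \<and> {w, l} \<in> E}"

lemma supports_in_V: "w \<in> supports \<Longrightarrow> w \<in> V"
  using edgeD by (auto simp: supports_def)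

lemma finite_supports: "finite supports"
  using finite_V supports_in_V finite_subset[of supports V] by blast

text \<open>Move away from \<open>x\<close>: the branch beyond the next vertex is strictly smaller,
  and when that vertex is a leaf the current one is a support.\<close>

lemma branch_contains_support:
  assumes "{x, y} \<in> E" "\<not> leaf E y"
  shows "\<exists>s \<in> supports. s \<in> branch x y"
  using assms
proof (induction "card (branch x y)" arbitrary: x y rule: less_induct)
  case less
  obtain z where z: "{y, z} \<in> E" "z \<noteq> x" using nonleaf_other_nbr less.prems by blast
  show ?case
  proof (cases "leaf E z")
    case True
    then show ?thesis using z target_in_branch[OF less.prems(1)] by (auto simp: supports_def)
  next
    case False
    have sub: "branch y z \<subseteq> branch x y" using branch_subset_beyond less.prems(1) z by blast
    moreover have "y \<notin> branch y z" "y \<in> branch x y"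
      using source_notin_branch z(1) target_in_branch less.prems(1) by auto
    ultimately have "card (branch y z) < card (branch x y)"
      by (intro psubset_card_mono finite_branch) blast
    then show ?thesis using less.hyps[OF _ z(1) False] sub by blast
  qed
qed

end

section \<open>Cyclic orders crossing every edge at most twice\<close>

context tree
begin

text \<open>A cyclic order encoded by its successor map. The second clause makes \<open>f\<close> a
  single cycle, as no proper nonempty part of \<open>S\<close> is mapped into itself. The third
  allows one crossing of each edge out of each of its two branches, hence two in all; it takes the
  place of the planar drawing.\<close>

definition ring :: "'a set \<Rightarrow> ('a \<Rightarrow> 'a) \<Rightarrow> bool" where
  "ring S f \<longleftrightarrow> f ` S = S \<and>
     (\<forall>X. S \<inter> X \<noteq> {} \<and> S - X \<noteq> {} \<longrightarrow> (\<exists>u \<in> S \<inter> X. f u \<notin> X)) \<and>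
     (\<forall>x y u v. {x, y} \<in> E \<and> u \<in> S \<inter> branch x y \<and> v \<in> S \<inter> branch x y \<and>
        f u \<notin> branch x y \<and> f v \<notin> branch x y \<longrightarrow> u = v)"

lemma ring_image: "ring S f \<Longrightarrow> f ` S = S"
  by (simp add: ring_def)

lemma ring_exit:
  assumes "ring S f" "a \<in> S" "a \<in> X" "b \<in> S" "b \<notin> X"
  obtains u where "u \<in> S" "u \<in> X" "f u \<notin> X"
proof -
  have "\<exists>u \<in> S \<inter> X. f u \<notin> X"
    using assms unfolding ring_def by (metis DiffI IntI empty_iff)
  then show ?thesis using that by blast
qed

lemma ring_exit_unique:
  assumes "ring S f" "{x, y} \<in> E" "u \<in> S" "u \<in> branch x y" "f u \<notin> branch x y"
    "v \<in> S" "v \<in> branch x y" "f v \<notin> branch x y"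
  shows "u = v"
  using assms unfolding ring_def by blast

lemma ringI:
  assumes "f ` S = S"
    and "\<And>X a b. a \<in> S \<Longrightarrow> a \<in> X \<Longrightarrow> b \<in> S \<Longrightarrow> b \<notin> X \<Longrightarrow> \<exists>u \<in> S. u \<in> X \<and> f u \<notin> X"
    and "\<And>x y u v. {x, y} \<in> E \<Longrightarrow> u \<in> S \<Longrightarrow> v \<in> S \<Longrightarrow> u \<in> branch x y \<Longrightarrow> v \<in> branch x y \<Longrightarrow>
        f u \<notin> branch x y \<Longrightarrow> f v \<notin> branch x y \<Longrightarrow> u = v"
  shows "ring S f"
  unfolding ring_def
proof (intro conjI allI impI)
  fix X assume "S \<inter> X \<noteq> {} \<and> S - X \<noteq> {}"
  then obtain a b where "a \<in> S" "a \<in> X" "b \<in> S" "b \<notin> X" by blast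
  then show "\<exists>u \<in> S \<inter> X. f u \<notin> X" using assms(2)[of a X b] by blast
qed (use assms(1,3) in auto)

text \<open>Says that \<open>L\<close> spans a subtree, in the form used for insertion: a new vertex
  next to \<open>L\<close> lies in a branch that contains no old vertex.\<close>

definition grown :: "'a set \<Rightarrow> bool" where
  "grown L \<longleftrightarrow> (\<forall>x y. {x, y} \<in> E \<and> x \<in> L \<and> y \<notin> L \<longrightarrow> L \<inter> branch x y = {})"

lemma grown_insert:
  assumes g: "grown L" and wv: "{w, v} \<in> E" "w \<in> L" "v \<notin> L" and L: "L \<subseteq> V"
  shows "grown (insert v L)"
  unfolding grown_def
proof (intro allI impI, elim conjE)
  fix x y assume xy: "{x, y} \<in> E" "x \<in> insert v L" "y \<notin> insert v L"
  show "insert v L \<inter> branch x y = {}"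
  proof (cases "x = v")
    case False
    then have "L \<inter> branch x y = {}" using g xy by (auto simp: grown_def)
    moreover have "v \<notin> branch x y"
      using branch_edge[OF xy(1) edge_sym[OF wv(1)]] calculation wv(2) xy(3) by blast
    ultimately show ?thesis by blast
  next
    \<comment> \<open>Seen from \<open>v\<close>, all of \<open>L\<close> lies beyond
      \<open>w\<close>, so the other branches at \<open>v\<close> miss it.\<close>
    case True
    have "L \<subseteq> branch v w"
      using g wv L branch_opposite[OF wv(1)] unfolding grown_def by blast
    then show ?thesis
      using branch_disjoint[OF edge_sym[OF wv(1)], of y] xy True wv(2) source_notin_branch by blast
  qed
qed

text \<open>The order \<open>w\<close>, \<open>f w\<close> becomes \<open>w\<close>,
  \<open>v\<close>, \<open>f w\<close>. An edge other than \<open>{w, v}\<close> has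
  \<open>v\<close> and \<open>w\<close> on the same side, so its crossings are the old ones. The
  edge \<open>{w, v}\<close> had no old vertex beyond it and is crossed once each way.\<close>

lemma ring_insert:
  assumes r: "ring L f" and g: "grown L" and wv: "{w, v} \<in> E" "w \<in> L" "v \<notin> L" and L: "L \<subseteq> V"
  shows "ring (insert v L) (f(w := v, v := f w))"
proof (rule ringI)
  let ?f = "f(w := v, v := f w)"
  have fw: "f w \<in> L" using ring_image[OF r] wv(2) by blast
  have "?f ` insert v L = insert v (f ` L)" using wv by auto
  then show "?f ` insert v L = insert v L" using ring_image[OF r] by simp
  show "\<exists>u \<in> insert v L. u \<in> X \<and> ?f u \<notin> X"
    if ab: "a \<in> insert v L" "a \<in> X" "b \<in> insert v L" "b \<notin> X" for X a b
  proof (cases "w \<in> X")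
    case True
    show ?thesis
    proof (cases "v \<in> X")
      case False then show ?thesis using True wv by auto
    next
      case v: True
      then have "b \<in> L" using ab by blast
      then obtain u where "u \<in> L" "u \<in> X" "f u \<notin> X" using ring_exit[OF r wv(2) True] ab by blast
      then show ?thesis using v wv by (cases "u = w") auto
    qed
  next
    case False
    have *: "\<exists>u \<in> insert v L. u \<in> X \<and> ?f u \<notin> X" if c: "c \<in> L" "c \<in> X" for c
    proof -
      obtain u where "u \<in> L" "u \<in> X" "f u \<notin> X" using ring_exit[OF r c wv(2) False] by blast
      then show ?thesis using False wv by (intro bexI[of _ u]) auto
    qed
    show ?thesis
    proof (cases "a = v")
      case False then show ?thesis using * ab by blast
    next
      case True
      then show ?thesis using *[OF fw] ab(2) by (cases "f w \<in> X") auto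
    qed
  qed
  fix x y u u'
  assume h: "{x, y} \<in> E" "u \<in> insert v L" "u' \<in> insert v L" "u \<in> branch x y" "u' \<in> branch x y"
    "?f u \<notin> branch x y" "?f u' \<notin> branch x y"
  have LB: "L \<inter> branch w v = {}" using g wv by (auto simp: grown_def)
  show "u = u'"
  proof (cases "{x, y} = {w, v}")
    case True
    then consider "x = w" "y = v" | "x = v" "y = w" by (auto simp: doubleton_eq_iff)
    then show ?thesis
    proof cases
      case 1
      then show ?thesis using h LB by blast
    next
      case 2
      then have "z \<in> branch x y" if "z \<in> L" for z
        using that LB L branch_opposite[OF wv(1)] by blast
      then have "z = w" if "z \<in> insert v L" "z \<in> branch x y" "?f z \<notin> branch x y" for z
        using that source_notin_branch[OF h(1)] 2 ring_image[OF r] fw by (auto split: if_splits)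
      then show ?thesis using h by blast
    qed
  next
    case False
    then have same: "w \<in> branch x y \<longleftrightarrow> v \<in> branch x y"
      using branch_edge[OF h(1) wv(1)] branch_edge[OF h(1) edge_sym[OF wv(1)]]
      by (auto simp: insert_commute)
    \<comment> \<open>The jump out of \<open>v\<close> stands for the former jump out of
      \<open>w\<close>, while the new jump from \<open>w\<close> to \<open>v\<close> crosses none of
      the edges considered here.\<close>
    define \<phi> where "\<phi> z = (if z = v then w else z)" for z
    have "\<phi> z \<in> L \<and> \<phi> z \<in> branch x y \<and> f (\<phi> z) \<notin> branch x y \<and> z \<noteq> w"
      if "z \<in> insert v L" "z \<in> branch x y" "?f z \<notin> branch x y" for z
      using that same wv by (auto simp: \<phi>_def split: if_splits)
    from this[OF h(2,4,6)] this[OF h(3,5,7)]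
    have "\<phi> u = \<phi> u' \<and> u \<noteq> w \<and> u' \<noteq> w"
      using ring_exit_unique[OF r h(1), of "\<phi> u" "\<phi> u'"] by simp
    then show ?thesis by (auto simp: \<phi>_def split: if_splits)
  qed
qed

text \<open>With \<open>p\<close> the predecessor of \<open>v\<close>, the jumps from
  \<open>p\<close> to \<open>v\<close> and from \<open>v\<close> onward merge into one. If the
  merged jump leaves a branch, so does one of the two: the second if \<open>v\<close> is in the
  branch, the first otherwise. This is the map \<open>\<phi>\<close> below.\<close>

lemma ring_remove:
  assumes r: "ring S f" and fin: "finite S" and v: "v \<in> S" "S \<noteq> {v}"
  shows "\<exists>f'. ring (S - {v}) f'"
proof -
  have im: "f ` S = S" by (rule ring_image[OF r])
  then have inj: "inj_on f S" using fin by (intro eq_card_imp_inj_on) auto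
  obtain p where p: "p \<in> S" "f p = v" using v im by (metis imageE)
  obtain b where "b \<in> S" "b \<notin> {v}" using v by blast
  then have "f v \<noteq> v" using ring_exit[OF r v(1), of "{v}" b] by auto
  then have pv: "p \<noteq> v" using p by auto
  let ?f = "f(p := f v)"
  have only: "f u = v \<Longrightarrow> u = p" if "u \<in> S" for u using inj p that by (auto dest: inj_onD)
  have fS: "f u \<in> S" if "u \<in> S" for u using im that by blast
  have "ring (S - {v}) ?f"
  proof (rule ringI)
    show "?f ` (S - {v}) = S - {v}"
    proof
      show "?f ` (S - {v}) \<subseteq> S - {v}" using only fS v \<open>f v \<noteq> v\<close> by (auto split: if_splits)
      show "S - {v} \<subseteq> ?f ` (S - {v})"
      proof
        fix x assume x: "x \<in> S - {v}"
        then obtain u where u: "u \<in> S" "f u = x" using im by (metis DiffD1 imageE)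
        show "x \<in> ?f ` (S - {v})"
        proof (cases "u = v")
          case True
          then have "x = ?f p" using u by simp
          then show ?thesis using p pv by blast
        next
          case False
          then have "x = ?f u" using u x p by auto
          then show ?thesis using u False by blast
        qed
      qed
    qed
  next
    fix X a b assume h: "a \<in> S - {v}" "a \<in> X" "b \<in> S - {v}" "b \<notin> X"
    \<comment> \<open>The exit from \<open>X - {v}\<close> may merely lead to \<open>v\<close>, and
      the exit from \<open>insert v X\<close> may start at \<open>v\<close>. If both happen, the
      merged jump from \<open>p\<close> leaves \<open>X\<close>.\<close>
    obtain u where u: "u \<in> S" "u \<in> X" "u \<noteq> v" "f u \<notin> X \<or> f u = v"
      using ring_exit[OF r, of a "X - {v}" b] h by blast
    obtain u' where u': "u' \<in> S" "u' \<in> X \<or> u' = v" "f u' \<notin> X" "f u' \<noteq> v"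
      using ring_exit[OF r, of a "insert v X" b] h by blast
    show "\<exists>u \<in> S - {v}. u \<in> X \<and> ?f u \<notin> X"
    proof (cases "u' = v")
      case False
      then show ?thesis using u' p by (intro bexI[of _ u']) auto
    next
      case True
      show ?thesis
      proof (cases "u = p")
        case True
        then show ?thesis using u u' \<open>u' = v\<close> by (intro bexI[of _ p]) auto
      next
        case False
        then show ?thesis using u only by (intro bexI[of _ u]) auto
      qed
    qed
  next
    fix x y u u' assume h: "{x, y} \<in> E" "u \<in> S - {v}" "u' \<in> S - {v}" "u \<in> branch x y" "u' \<in> branch x y"
      "?f u \<notin> branch x y" "?f u' \<notin> branch x y"
    define \<phi> where "\<phi> z = (if z = p \<and> v \<in> branch x y then v else z)" for z
    have "\<phi> z \<in> S \<and> \<phi> z \<in> branch x y \<and> f (\<phi> z) \<notin> branch x y"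
      if "z \<in> S - {v}" "z \<in> branch x y" "?f z \<notin> branch x y" for z
      using that v p by (auto simp: \<phi>_def split: if_splits)
    from this[OF h(2,4,6)] this[OF h(3,5,7)]
    have "\<phi> u = \<phi> u'"
      using ring_exit_unique[OF r h(1), of "\<phi> u" "\<phi> u'"] by simp
    then show "u = u'" using h by (auto simp: \<phi>_def split: if_splits)
  qed
  then show ?thesis by blast
qed

lemma ring_all: "\<exists>f. ring V f"
proof -
  obtain r where r: "r \<in> V" using tree by (auto simp: is_tree_def)
  have "\<exists>L f. L \<subseteq> V \<and> card L = Suc k \<and> ring L f \<and> grown L" if "Suc k \<le> card V" for k
    using that
  proof (induction k)
    case 0
    have "ring {r} (\<lambda>a. a)" by (rule ringI) auto
    moreover have "grown {r}" using source_notin_branch by (auto simp: grown_def)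
    ultimately show ?case using r by (intro exI[of _ "{r}"] exI[of _ "\<lambda>a. a"]) auto
  next
    case (Suc k)
    then obtain L f where L: "L \<subseteq> V" "card L = Suc k" "ring L f" "grown L" by auto
    have finL: "finite L" using L(1) finite_V finite_subset by blast
    have "L \<noteq> V" using L(2) Suc.prems by auto
    then obtain b where b: "b \<in> V" "b \<notin> L" using L(1) by blast
    obtain a where a: "a \<in> L" using L(2) by (metis card.empty ex_in_conv nat.distinct(1))
    have "\<exists>w v. w \<in> L \<and> v \<notin> L \<and> {w, v} \<in> E"
    proof (rule ccontr)
      assume n: "\<not> ?thesis"
      have "b \<in> L"
        by (rule joined_induct[OF all_joined[of a b]]) (use a b n L(1) in blast)+
      then show False using b by simp
    qed
    then obtain w v where wv: "{w, v} \<in> E" "w \<in> L" "v \<notin> L" by blast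
    have "v \<in> V" using edgeD wv(1) by blast
    then show ?case
      using ring_insert[OF L(3,4) wv L(1)] grown_insert[OF L(4) wv L(1)] L(1,2) wv(3) finL
      by (intro exI[of _ "insert v L"]) auto
  qed
  moreover obtain k where "card V = Suc k" using r finite_V by (metis card_gt_0_iff empty_iff gr0_implies_Suc)
  ultimately obtain L f where "L \<subseteq> V" "card L = card V" "ring L f" by (metis order_refl)
  then show ?thesis using card_subset_eq[OF finite_V] by blast
qed

text \<open>\<open>ring_insert\<close> requires the new vertex to be adjacent to an old one, and
  \<open>S\<close> may contain no adjacent vertices. So an order of all of \<open>V\<close> is grown
  first, and the vertices outside \<open>S\<close> are dropped from it.\<close>

lemma ring_exists:
  assumes "S \<subseteq> V" "S \<noteq> {}"
  shows "\<exists>f. ring S f"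
proof -
  have "finite R \<Longrightarrow> S \<inter> R = {} \<Longrightarrow> S \<union> R \<subseteq> V \<Longrightarrow> \<exists>f. ring (S \<union> R) f \<Longrightarrow> \<exists>f. ring S f" for R
  proof (induction R rule: finite_induct)
    case (insert v R)
    obtain f where f: "ring (S \<union> insert v R) f" using insert.prems by blast
    have "S \<union> insert v R - {v} = S \<union> R" using insert.hyps(2) insert.prems(1) by auto
    moreover have "S \<union> insert v R \<noteq> {v}" using assms(2) insert.prems(1) by auto
    moreover have "finite (S \<union> insert v R)" using finite_subset[OF insert.prems(2) finite_V] .
    ultimately have "\<exists>f. ring (S \<union> R) f" using ring_remove[OF f, of v] by auto
    then show ?case using insert.IH insert.prems(1,2) by auto
  qed auto
  moreover have "S \<union> (V - S) = V" using assms by blast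
  ultimately show ?thesis using ring_all finite_V by (metis Diff_disjoint finite_Diff order_refl)
qed

end

section \<open>Separating the vertices of degree two\<close>

context tree
begin

text \<open>A path meets both ends of its edge number \<open>b\<close> only there, so it changes
  sides exactly once, and position decides the side.\<close>

lemma path_branch_side:
  assumes p: "is_path V E p" and "Suc b < length p" "k < length p"
  shows "p ! k \<in> branch (p ! b) (p ! Suc b) \<longleftrightarrow> b < k"
proof -
  have e: "{p ! b, p ! Suc b} \<in> E" using path_edge p assms(2) by blast
  have dist: "distinct p" using p by (auto simp: is_path_def)
  show ?thesis
  proof (cases "k \<le> b")
    case True
    have "p ! k \<notin> branch (p ! b) (p ! Suc b)"
    proof
      assume "p ! k \<in> branch (p ! b) (p ! Suc b)"
      then obtain l where "l < b" "p ! l = p ! Suc b"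
        using path_leaves_branch[OF e p True] assms(2) source_notin_branch[OF e] by auto
      then show False using dist assms(2) nth_eq_iff_index_eq[of p l "Suc b"] by auto
    qed
    then show ?thesis using True by simp
  next
    case False
    have "p ! k \<in> branch (p ! b) (p ! Suc b)"
    proof (rule ccontr)
      assume "p ! k \<notin> branch (p ! b) (p ! Suc b)"
      then obtain l where l: "Suc b \<le> l" "l < k" "p ! Suc l = p ! b"
        using path_leaves_branch[OF e p, of "Suc b" k] False assms(3) target_in_branch[OF e] by auto
      then show False using dist assms(2,3) nth_eq_iff_index_eq[of p "Suc l" b] by auto
    qed
    then show ?thesis using False by simp
  qed
qed

text \<open>Degree two provides a neighbour other than \<open>q ! 1\<close>. If it were on the path
  it would sit at position two or later, and the initial segment up to it would close to a
  cycle.\<close>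

lemma path_extend_front:
  assumes q: "is_path V E q" "2 \<le> length q" "degree E (hd q) = 2"
  shows "\<exists>z. is_path V E (z # q)"
proof -
  have ne: "q \<noteq> []" using q by auto
  then have h: "hd q = q ! 0" by (simp add: hd_conv_nth)
  obtain z where z: "{hd q, z} \<in> E" "z \<notin> {q ! 1}" using nbr_avoiding[of "{q ! 1}" "hd q"] q by auto
  have "z \<notin> set q"
  proof
    assume "z \<in> set q"
    then obtain k where k: "k < length q" "z = q ! k" by (auto simp: in_set_conv_nth)
    have "k \<noteq> 0" using edgeD[OF z(1)] k(2) h by metis
    moreover have "k \<noteq> 1" using z k by auto
    ultimately have "3 \<le> length (take (Suc k) q)" using k by auto
    moreover have "last (take (Suc k) q) = z" using k by (simp add: take_Suc_conv_app_nth)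
    moreover have "hd (take (Suc k) q) = hd q" using ne by simp
    ultimately have "is_cycle V E (take (Suc k) q)"
      using is_path_take[OF q(1)] z(1) by (simp add: is_cycle_def insert_commute)
    then show False using no_cycle by blast
  qed
  then show ?thesis using is_path_Cons[OF q(1), of z] z edgeD by (auto simp: insert_commute)
qed

text \<open>Take a longest path that contains \<open>p\<close> and has only inner vertices of degree
  two. An end of degree two could be prolonged, so the ends are as a bare path requires.\<close>

lemma extends_to_bare_path:
  assumes p: "is_path V E p" "2 \<le> length p" "\<And>v. v \<in> set p \<Longrightarrow> degree E v = 2"
  shows "\<exists>xs ys. is_bare_path V E (xs @ p @ ys)"
proof -
  let ?Q = "\<lambda>q. is_path V E q \<and> (\<exists>xs ys. q = xs @ p @ ys) \<and>
    (\<forall>i. 0 < i \<and> Suc i < length q \<longrightarrow> degree E (q ! i) = 2)"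
  have "?Q p" using p by (auto intro: exI[of _ "[]"])
  moreover have "\<forall>q. ?Q q \<longrightarrow> length q < Suc (card V)"
    using finite_V by (auto simp: is_path_def less_Suc_eq_le card_mono simp flip: distinct_card)
  ultimately obtain q where q: "?Q q" "\<And>q'. ?Q q' \<Longrightarrow> length q' \<le> length q"
    using ex_has_greatest_nat[of ?Q p length "Suc (card V)"] by blast
  obtain xs ys where xy: "q = xs @ p @ ys" using q(1) by blast
  have len: "2 \<le> length q" using xy p(2) by simp
  then have ne: "q \<noteq> []" by auto
  have "degree E (hd q) \<noteq> 2"
  proof
    assume d: "degree E (hd q) = 2"
    then obtain z where z: "is_path V E (z # q)" using path_extend_front q(1) len by blast
    have "degree E ((z # q) ! i) = 2" if "0 < i" "Suc i < length (z # q)" for i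
      using that q(1) d ne by (cases i; cases "i - 1") (auto simp: hd_conv_nth)
    then have "?Q (z # q)" using z xy by (auto intro: exI[of _ "z # xs"])
    from q(2)[OF this] show False by simp
  qed
  moreover have "degree E (last q) \<noteq> 2"
  proof
    assume d: "degree E (last q) = 2"
    then obtain z where "is_path V E (z # rev q)"
      using path_extend_front[OF is_path_rev] q(1) len by (auto simp: hd_rev)
    then have z: "is_path V E (q @ [z])" using is_path_rev[of V E "z # rev q"] by simp
    have "degree E ((q @ [z]) ! i) = 2" if i: "0 < i" "Suc i < length (q @ [z])" for i
    proof (cases "Suc i = length q")
      case True
      then have "q ! i = last q" using ne by (metis diff_Suc_1 last_conv_nth)
      then show ?thesis using True d by (simp add: nth_append)
    next
      case False
      then show ?thesis using i q(1) by (auto simp: nth_append)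
    qed
    then have "?Q (q @ [z])" using z xy by auto
    from q(2)[OF this] show False by simp
  qed
  ultimately have "is_bare_path V E q" using q(1) len by (simp add: is_bare_path_def)
  then show ?thesis using xy by blast
qed

text \<open>The edges that the extra paths have to deal with. Edges at a leaf are excluded, which
  keeps their number below \<open>h2_star\<close>.\<close>

definition mid_edges :: "'a set set" where
  "mid_edges = {e \<in> E. \<forall>v\<in>e. degree E v = 2}"

text \<open>The first and the last edge each contain an end vertex, whose degree is not two. If they
  coincide, the truncated subtraction gives zero, which is still correct.\<close>

lemma card_mid_edges_of_bare_path:
  assumes p: "is_bare_path V E p"
  shows "card (path_edges p \<inter> mid_edges) \<le> card (path_edges p) - 2"
proof -
  have dist: "distinct p" and len: "2 \<le> length p" and ne: "p \<noteq> []"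
    and hd: "degree E (p ! 0) \<noteq> 2" and last: "degree E (p ! (length p - 1)) \<noteq> 2"
    using p by (auto simp: is_bare_path_def is_path_def hd_conv_nth last_conv_nth)
  have "path_edges p \<inter> mid_edges \<subseteq> (\<lambda>i. {p ! i, p ! Suc i}) ` {1..<length p - 2}"
  proof
    fix e assume e: "e \<in> path_edges p \<inter> mid_edges"
    then obtain i where i: "Suc i < length p" "e = {p ! i, p ! Suc i}" by (auto simp: path_edges_def)
    then have "degree E (p ! i) = 2" "degree E (p ! Suc i) = 2" using e by (auto simp: mid_edges_def)
    then have "i \<noteq> 0" "Suc i \<noteq> length p - 1" using hd last by metis+
    then show "e \<in> (\<lambda>i. {p ! i, p ! Suc i}) ` {1..<length p - 2}" using i by auto
  qed
  then have "card (path_edges p \<inter> mid_edges) \<le> card ((\<lambda>i. {p ! i, p ! Suc i}) ` {1..<length p - 2})"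
    by (intro card_mono) auto
  also have "\<dots> \<le> length p - 3" using card_image_le[of "{1..<length p - 2}"] by fastforce
  finally show ?thesis using card_path_edges[OF dist] by simp
qed

lemma card_mid_edges: "card mid_edges \<le> h2_star V E"
proof -
  let ?I = "long_inner_bare_paths V E" and ?B = "bare_paths V E"
  have b: "card (P \<inter> mid_edges) \<le> card P - 2" if "P \<in> ?B" for P
    using that card_mid_edges_of_bare_path by (auto simp: bare_paths_def)
  have "mid_edges \<subseteq> (\<Union>P\<in>?B. P \<inter> mid_edges)"
  proof
    fix e assume e: "e \<in> mid_edges"
    then have eE: "e \<in> E" by (simp add: mid_edges_def)
    obtain x y where xy: "e = {x, y}" "x \<in> V" "y \<in> V" "x \<noteq> y" using edge_obtain[OF eE] by blast
    have "is_path V E [x, y]" using xy eE by (auto simp: is_path_def less_Suc_eq)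
    moreover have "degree E v = 2" if "v \<in> set [x, y]" for v using that e xy by (auto simp: mid_edges_def)
    ultimately obtain xs ys where q: "is_bare_path V E (xs @ [x, y] @ ys)"
      using extends_to_bare_path[of "[x, y]"] by auto
    have "e \<in> path_edges (xs @ [x, y] @ ys)"
      unfolding path_edges_def by (auto simp: xy(1) nth_append intro!: exI[of _ "length xs"])
    then show "e \<in> (\<Union>P\<in>?B. P \<inter> mid_edges)" using q e by (auto simp: bare_paths_def)
  qed
  moreover have "finite (\<Union>P\<in>?B. P \<inter> mid_edges)"
    by (rule finite_subset[OF _ finite_E]) (auto simp: mid_edges_def)
  ultimately have "card mid_edges \<le> card (\<Union>P\<in>?B. P \<inter> mid_edges)" by (intro card_mono)
  also have "\<dots> \<le> (\<Sum>P\<in>?B. card (P \<inter> mid_edges))" by (rule card_UN_le[OF finite_bare_paths])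
  also have "\<dots> = (\<Sum>P\<in>?B - ?I. card (P \<inter> mid_edges)) + (\<Sum>P\<in>?I. card (P \<inter> mid_edges))"
    by (rule sum.subset_diff) (auto simp: long_inner_bare_paths_def finite_bare_paths)
  also have "\<dots> \<le> h2_star V E"
    unfolding h2_star_def
  proof (rule add_mono; rule sum_mono)
    show "card (P \<inter> mid_edges) \<le> card P - 1" if "P \<in> ?B - ?I" for P using b[of P] that by auto
    show "card (P \<inter> mid_edges) \<le> card P - 2" if "P \<in> ?I" for P
      using b[of P] that by (auto simp: long_inner_bare_paths_def)
  qed
  finally show ?thesis .
qed

section \<open>Extra paths separating the inside of bare paths\<close>

definition between :: "'a list \<Rightarrow> nat \<Rightarrow> nat \<Rightarrow> 'a set set" where
  "between p i j = {{p ! a, p ! Suc a} | a. i \<le> a \<and> a < j}"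

text \<open>Models a pair of vertices inside one bare path, the only kind of nonleaf pair that the
  core family may fail to separate. The outer inequalities keep both away from the ends of the bare
  path, so both have degree two.\<close>

definition inner_segment :: "'a list \<Rightarrow> nat \<Rightarrow> nat \<Rightarrow> bool" where
  "inner_segment p i j \<longleftrightarrow> is_bare_path V E p \<and> 0 < i \<and> i < j \<and> Suc j < length p"

lemma inner_segment_degree:
  "inner_segment p i j \<Longrightarrow> i \<le> k \<Longrightarrow> k \<le> j \<Longrightarrow> degree E (p ! k) = 2"
  by (auto simp: inner_segment_def is_bare_path_def)

lemma inner_segment_path: "inner_segment p i j \<Longrightarrow> is_path V E p"
  by (auto simp: inner_segment_def is_bare_path_def)

lemma between_mid_edges: "inner_segment p i j \<Longrightarrow> between p i j \<subseteq> mid_edges"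
  using inner_segment_degree[of p i j] path_edge[OF inner_segment_path[of p i j]]
  by (fastforce simp: between_def mid_edges_def inner_segment_def)

text \<open>\<open>R\<close> begins just behind \<open>p ! a\<close> and stays beyond it, so it
  misses \<open>p ! i\<close>. If it also missed \<open>p ! j\<close>, it would be trapped in the
  open segment between \<open>p ! a\<close> and \<open>p ! j\<close>; there every edge at
  \<open>z\<close> belongs to \<open>between p i j\<close>, contrary to the choice of
  \<open>t\<close>.\<close>

lemma connector_separates_forward:
  assumes s: "inner_segment p i j" and a: "i \<le> a" "a < j"
    and R: "is_path V E R" "set R \<subseteq> branch (p ! a) (p ! Suc a)" "p ! Suc a \<in> set R" "z \<in> set R"
    and f: "{z, t} \<in> E" "{z, t} \<notin> between p i j"
  shows "p ! i \<notin> set R" "p ! j \<in> set R"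
proof -
  have p: "is_path V E p" and len: "Suc j < length p" using s inner_segment_path by (auto simp: inner_segment_def)
  let ?x = "p ! a" and ?y = "p ! Suc a"
  have e: "{?x, ?y} \<in> E" using path_edge[OF p] a len by auto
  show "p ! i \<notin> set R" using path_branch_side[OF p, of a i] a len R(2) by auto
  show "p ! j \<in> set R"
  proof (cases "j = Suc a")
    case True
    then show ?thesis using R by simp
  next
    case False
    define k where "k = j - 1"
    have k: "j = Suc k" "a < k" using False a by (auto simp: k_def)
    have g: "{p ! k, p ! j} \<in> E" using path_edge[OF p, of k] k len by auto
    show ?thesis
    proof (rule ccontr)
      assume nj: "p ! j \<notin> set R"
      have ynot: "?y \<notin> branch (p ! k) (p ! j)" using path_branch_side[OF p, of k "Suc a"] k len by auto
      have Rnot: "v \<notin> branch (p ! k) (p ! j)" if "v \<in> set R" for v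
        using path_crosses_edge[OF g R(1) that R(3)] ynot nj by blast
      \<comment> \<open>The open segment is a chain of degree-two vertices. Its only neighbours
        outside are \<open>p ! a\<close> and \<open>p ! j\<close>, both off \<open>R\<close>, so
        \<open>R\<close> cannot leave it.\<close>
      define M where "M = {p ! l | l. a < l \<and> l < j}"
      have nbr: "w = p ! (l - 1) \<or> w = p ! Suc l" if l: "a < l" "l < j" and w: "{p ! l, w} \<in> E" for l w
      proof -
        have "{p ! l, p ! (l - 1)} \<in> E" "{p ! l, p ! Suc l} \<in> E"
          using path_edge[OF p, of "l - 1"] path_edge[OF p, of l] l len by (auto simp: insert_commute)
        moreover have "p ! (l - 1) \<noteq> p ! Suc l"
          using p l len by (auto simp: is_path_def nth_eq_iff_index_eq)
        moreover have "degree E (p ! l) \<le> 2" using inner_segment_degree[OF s, of l] l a by auto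
        ultimately show ?thesis using degree2_nbr w by blast
      qed
      have "z \<in> M"
      proof (rule ccontr)
        assume "z \<notin> M"
        moreover have "?y \<in> M" using k unfolding M_def by blast
        moreover obtain n m where "n < length R" "m < length R" "R ! n = ?y" "R ! m = z"
          using R(3,4) by (auto simp: in_set_conv_nth)
        ultimately obtain c where c: "Suc c < length R"
          "(R ! c \<in> M \<and> R ! Suc c \<notin> M) \<or> (R ! c \<notin> M \<and> R ! Suc c \<in> M)"
          using path_change[of n m "\<lambda>v. v \<in> M" R] path_change[of m n "\<lambda>v. v \<notin> M" R]
          by (metis (no_types, lifting) Suc_lessI le_less_Suc_eq less_trans_Suc nat_le_linear not_less_eq)
        then obtain u w where uw: "u \<in> M" "w \<notin> M" "{u, w} \<in> E" "w \<in> set R"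
          using path_edge[OF R(1) c(1)] by (metis Suc_lessD insert_commute nth_mem)
        then obtain l where l: "a < l" "l < j" "u = p ! l" by (auto simp: M_def)
        have "w = p ! (l - 1) \<or> w = p ! Suc l" using nbr l uw by blast
        then have "w = ?x \<or> w = p ! j"
        proof
          assume h: "w = p ! (l - 1)"
          then have "\<not> a < l - 1" using uw(2) l unfolding M_def by auto
          then have "l - 1 = a" using l by auto
          then show ?thesis using h by simp
        next
          assume h: "w = p ! Suc l"
          then have "\<not> Suc l < j" using uw(2) l unfolding M_def by auto
          then have "Suc l = j" using l by auto
          then show ?thesis using h by simp
        qed
        then show False using uw(4) nj R(2) source_notin_branch[OF e] by auto
      qed
      then obtain l where l: "a < l" "l < j" "z = p ! l" by (auto simp: M_def)
      have "t = p ! (l - 1) \<or> t = p ! Suc l" using nbr l f by blast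
      then have "{z, t} \<in> between p i j"
      proof
        assume "t = p ! (l - 1)"
        then have "{z, t} = {p ! (l - 1), p ! Suc (l - 1)}" using l by (simp add: insert_commute)
        moreover have "i \<le> l - 1" "l - 1 < j" using l a by auto
        ultimately show ?thesis unfolding between_def by blast
      next
        assume "t = p ! Suc l"
        then show ?thesis using l a unfolding between_def by auto
      qed
      then show False using f by simp
    qed
  qed
qed

lemma inner_segment_rev:
  assumes s: "inner_segment p i j"
  defines "n \<equiv> length p - 1"
  shows "inner_segment (rev p) (n - j) (n - i)" "between (rev p) (n - j) (n - i) = between p i j"
    "\<And>k. k \<le> n \<Longrightarrow> rev p ! (n - k) = p ! k"
proof -
  have len: "0 < i" "i < j" "Suc j < length p" using s by (auto simp: inner_segment_def)
  show r: "rev p ! (n - k) = p ! k" if "k \<le> n" for k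
    using that len by (simp add: rev_nth n_def)
  show "inner_segment (rev p) (n - j) (n - i)"
    using s len is_bare_path_rev by (auto simp: inner_segment_def n_def)
  have "{rev p ! (n - Suc a), rev p ! Suc (n - Suc a)} = {p ! a, p ! Suc a}" if "a < j" for a
    using r[of a] r[of "Suc a"] that len by (simp add: n_def insert_commute Suc_diff_Suc)
  moreover have "\<exists>a. b = n - Suc a \<and> i \<le> a \<and> a < j" if "n - j \<le> b" "b < n - i" for b
    using that len by (intro exI[of _ "n - Suc b"]) (auto simp: n_def)
  moreover have "n - j \<le> n - Suc a \<and> n - Suc a < n - i" if "i \<le> a" "a < j" for a
    using that len by (auto simp: n_def)
  ultimately show "between (rev p) (n - j) (n - i) = between p i j"
    unfolding between_def by (safe; metis)
qed

lemma connector_separates: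
  assumes s: "inner_segment p i j" and e: "{x, y} \<in> between p i j"
    and R: "is_path V E R" "set R \<subseteq> branch x y" "y \<in> set R" "z \<in> set R"
    and f: "{z, t} \<in> E" "{z, t} \<notin> between p i j"
  shows "(p ! i \<in> set R) \<noteq> (p ! j \<in> set R)"
proof -
  obtain a where a: "i \<le> a" "a < j" "{x, y} = {p ! a, p ! Suc a}"
    using e by (auto simp: between_def)
  then consider "x = p ! a" "y = p ! Suc a" | "x = p ! Suc a" "y = p ! a"
    by (auto simp: doubleton_eq_iff)
  then show ?thesis
  proof cases
    case 1
    then show ?thesis using connector_separates_forward[OF s a(1,2) R(1) _ _ R(4) f] R by blast
  next
    case 2
    define n where "n = length p - 1"
    note r = inner_segment_rev[OF s, folded n_def]
    have len: "0 < i" "i < j" "j < n" using s by (auto simp: inner_segment_def n_def)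
    have "rev p ! (n - Suc a) = x" "rev p ! Suc (n - Suc a) = y"
      using r(3)[of a] r(3)[of "Suc a"] 2 a len by (simp_all add: Suc_diff_Suc)
    then have "rev p ! (n - j) \<notin> set R \<and> rev p ! (n - i) \<in> set R"
      using connector_separates_forward[OF r(1), of "n - Suc a" R z t] R f r(2) a len by auto
    then show ?thesis using r(3) len by simp
  qed
qed

text \<open>\<open>R\<close> joins the facing ends of the two edges and omits the far ends. A
  segment containing just one of the edges has one end on the far side of that edge, while
  \<open>R\<close> runs on past its other end.\<close>

lemma connector_exists:
  assumes e: "e \<in> E" and f: "f \<in> E" and ef: "e \<noteq> f"
  obtains R where "is_path V E R"
    "\<And>p i j. inner_segment p i j \<Longrightarrow> (e \<in> between p i j) \<noteq> (f \<in> between p i j) \<Longrightarrow>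
        (p ! i \<in> set R) \<noteq> (p ! j \<in> set R)"
proof -
  obtain x' y' where x'y': "e = {x', y'}" "x' \<in> V" "y' \<in> V" using edge_obtain[OF e] by blast
  obtain z' t' where z't': "f = {z', t'}" "z' \<in> V" "t' \<in> V" using edge_obtain[OF f] by blast
  \<comment> \<open>The ends are named so that the edges face each other: \<open>y\<close> is the
    end of \<open>e\<close> on the side of \<open>f\<close>, and \<open>z\<close> below is the end
    of \<open>f\<close> on the side of \<open>e\<close>. They may coincide.\<close>
  obtain x y where xy: "e = {x, y}" "z' \<in> branch x y"
    using x'y' z't'(2) branch_cover[of x' y' z'] e by (auto simp: insert_commute)
  have eE: "{x, y} \<in> E" using e xy by simp
  have t': "t' \<in> branch x y"
    using branch_edge[OF eE _ xy(2)] f z't' ef xy(1) by (auto simp: insert_commute)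
  have yV: "y \<in> V" using edgeD eE by blast
  obtain z t where zt: "f = {t, z}" "y \<in> branch t z" "z \<in> branch x y"
    using z't' yV branch_cover[of t' z' y] f xy(2) t' by (auto simp: insert_commute)
  have fE: "{t, z} \<in> E" using f zt by simp
  have zV: "z \<in> V" using edgeD fE by blast
  note R = tpath[OF yV zV]
  have R1: "set (tpath y z) \<subseteq> branch x y"
    using path_within_branch[OF eE R(1)] R zt(3) target_in_branch[OF eE] by auto
  have R2: "set (tpath y z) \<subseteq> branch t z"
    using path_within_branch[OF fE R(1)] R zt(2) target_in_branch[OF fE] by auto
  show ?thesis
  proof (rule that[OF R(1)])
    fix p i j assume s: "inner_segment p i j" and b: "(e \<in> between p i j) \<noteq> (f \<in> between p i j)"
    show "(p ! i \<in> set (tpath y z)) \<noteq> (p ! j \<in> set (tpath y z))"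
    proof (cases "e \<in> between p i j")
      case True
      then show ?thesis
        using connector_separates[OF s _ R(1) R1 R(4,5), of t] b fE zt(1) xy(1)
        by (simp add: insert_commute)
    next
      case False
      then show ?thesis
        using connector_separates[OF s _ R(1) R2 R(5,4), of x] b eE zt(1) xy(1)
        by (simp add: insert_commute)
    qed
  qed
qed

text \<open>The edges number \<open>a\<close> and \<open>c\<close> lie on different sides of edge
  number \<open>b\<close>, so the stretch of \<open>q\<close> containing both must cross that
  edge.\<close>

lemma middle_edge_between:
  assumes p: "is_path V E p" and abc: "a < b" "b < c" "Suc c < length p"
    and s: "inner_segment q i j"
    and e: "{p ! a, p ! Suc a} \<in> between q i j" "{p ! c, p ! Suc c} \<in> between q i j"
  shows "{p ! b, p ! Suc b} \<in> between q i j"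
proof -
  let ?B = "branch (p ! b) (p ! Suc b)"
  have g: "{p ! b, p ! Suc b} \<in> E" using path_edge p abc by auto
  have q: "is_path V E q" and len: "Suc j < length q"
    using s inner_segment_path by (auto simp: inner_segment_def)
  obtain k where k: "i \<le> k" "k < j" "{p ! a, p ! Suc a} = {q ! k, q ! Suc k}"
    using e by (auto simp: between_def)
  obtain l where l: "i \<le> l" "l < j" "{p ! c, p ! Suc c} = {q ! l, q ! Suc l}"
    using e by (auto simp: between_def)
  have "p ! a \<notin> ?B" "p ! Suc a \<notin> ?B" "p ! c \<in> ?B" "p ! Suc c \<in> ?B"
    using path_branch_side[OF p, of b] abc by auto
  then have kl: "q ! k \<notin> ?B" "q ! l \<in> ?B" using k l by (auto simp: doubleton_eq_iff)
  obtain m where m: "i \<le> m" "m < j" "{p ! b, p ! Suc b} = {q ! m, q ! Suc m}"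
  proof (cases "k \<le> l")
    case True
    obtain m where "k \<le> m" "m < l" "q ! m = p ! b" "q ! Suc m = p ! Suc b"
      using path_enters_branch[OF g q True] kl l len by auto
    then show ?thesis using that[of m] k l by auto
  next
    case False
    obtain m where "l \<le> m" "m < k" "q ! m = p ! Suc b" "q ! Suc m = p ! b"
      using path_leaves_branch[OF g q, of l k] False kl k len by auto
    then show ?thesis using that[of m] k l by auto
  qed
  then show ?thesis unfolding between_def by blast
qed

text \<open>If two edges of \<open>D\<close> share no bare path, no segment contains both. Otherwise
  any three edges of \<open>D\<close> lie on a common bare path, since bare paths sharing an edge
  agree; the outer two then have the middle one as witness.\<close>

lemma spread_pair_exists:
  assumes D: "D \<subseteq> mid_edges" "3 \<le> card D"
  shows "\<exists>e\<in>D. \<exists>f\<in>D. e \<noteq> f \<and>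
    (\<forall>p i j. inner_segment p i j \<and> e \<in> between p i j \<and> f \<in> between p i j \<longrightarrow>
       (\<exists>g \<in> D - {e, f}. g \<in> between p i j))"
proof (cases "\<exists>e\<in>D. \<exists>f\<in>D. e \<noteq> f \<and> (\<forall>p. is_bare_path V E p \<longrightarrow> \<not> (e \<in> path_edges p \<and> f \<in> path_edges p))")
  case True
  moreover have "between p i j \<subseteq> path_edges p" if "inner_segment p i j" for p i j
    using that by (auto simp: between_def path_edges_def inner_segment_def)
  ultimately show ?thesis by (metis inner_segment_def subsetD)
next
  case False
  then have share: "\<exists>p. is_bare_path V E p \<and> e \<in> path_edges p \<and> f \<in> path_edges p"
    if "e \<in> D" "f \<in> D" "e \<noteq> f" for e f using that by blast
  obtain T where T: "T \<subseteq> D" "card T = 3" using D(2) obtain_subset_with_card_n by metis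
  then obtain e f g where efg: "T = {e, f, g}" "e \<noteq> f" "e \<noteq> g" "f \<noteq> g" by (auto simp: card_3_iff)
  obtain p where p: "is_bare_path V E p" "e \<in> path_edges p" "f \<in> path_edges p"
    using share[of e f] T efg by auto
  obtain q where q: "is_bare_path V E q" "e \<in> path_edges q" "g \<in> path_edges q"
    using share[of e g] T efg by auto
  have "path_edges p = path_edges q" using bare_path_edges_eq p q by blast
  then have "g \<in> path_edges p" using q by simp
  have P: "is_path V E p" using p by (simp add: is_bare_path_def)
  define edge where "edge i = {p ! i, p ! Suc i}" for i
  obtain a b c where abc: "edge a = e" "edge b = f" "edge c = g" "Suc a < length p" "Suc b < length p" "Suc c < length p"
    using p \<open>g \<in> path_edges p\<close> by (auto simp: path_edges_def edge_def)
  have *: ?thesis if "i < j" "j < k" "Suc k < length p" "edge i \<in> D" "edge j \<in> D" "edge k \<in> D" for i j k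
  proof -
    have "edge r \<noteq> edge s" if "Suc r < length p" "Suc s < length p" "r \<noteq> s" for r s
      using path_edges_idx_inj[of p r s] P that by (auto simp: edge_def is_path_def)
    then have "edge i \<noteq> edge k" "edge j \<noteq> edge i" "edge j \<noteq> edge k" using that by auto
    then have j: "edge j \<in> D - {edge i, edge k}" and ik: "edge i \<noteq> edge k" using that by auto
    have "edge j \<in> between q i' j'"
      if "inner_segment q i' j'" "edge i \<in> between q i' j'" "edge k \<in> between q i' j'" for q i' j'
      using middle_edge_between[OF P \<open>i < j\<close> \<open>j < k\<close> \<open>Suc k < length p\<close>] that
      unfolding edge_def by blast
    with j have "\<forall>p i' j'. inner_segment p i' j' \<and> edge i \<in> between p i' j' \<and> edge k \<in> between p i' j'
      \<longrightarrow> (\<exists>g \<in> D - {edge i, edge k}. g \<in> between p i' j')"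
      by meson
    then show ?thesis using ik \<open>edge i \<in> D\<close> \<open>edge k \<in> D\<close> by meson
  qed
  have "a \<noteq> b" "b \<noteq> c" "a \<noteq> c" using abc efg by auto
  moreover have "edge a \<in> D" "edge b \<in> D" "edge c \<in> D" using abc T efg by auto
  ultimately show ?thesis using * abc(4-6) by (metis linorder_neqE_nat)
qed

text \<open>Relative to \<open>D\<close> so that edges can be removed in an induction. For
  \<open>D = mid_edges\<close> every inner segment qualifies, as all its edges are mid
  edges.\<close>

definition mid_separates :: "'a set set \<Rightarrow> 'a list set \<Rightarrow> bool" where
  "mid_separates D G \<longleftrightarrow> (\<forall>p i j. inner_segment p i j \<and> D \<inter> between p i j \<noteq> {} \<longrightarrow>
     (\<exists>g\<in>G. (p ! i \<in> set g) \<noteq> (p ! j \<in> set g)))"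

text \<open>While three edges are left, a spread pair is removed at the price of one path. At most
  two edges remain, and each gets its own path towards \<open>f0\<close>, an edge outside every
  segment. The bound \<open>card D div 2 + 1\<close> covers this since it is 1, 1, 2 for zero, one
  and two edges.\<close>

lemma mid_family_exists:
  assumes f0: "f0 \<in> E" "f0 \<notin> mid_edges"
  shows "D \<subseteq> mid_edges \<Longrightarrow> \<exists>G. finite G \<and> card G \<le> card D div 2 + 1 \<and>
    (\<forall>p\<in>G. is_path V E p) \<and> mid_separates D G"
proof (induction "card D" arbitrary: D rule: less_induct)
  case less
  have fin: "finite D" by (rule finite_subset[OF less.prems]) (simp add: mid_edges_def finite_E)
  have DE: "D \<subseteq> E" using less.prems by (auto simp: mid_edges_def)
  show ?case
  proof (cases "3 \<le> card D")
    case False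
    have "\<exists>R. is_path V E R \<and> mid_separates {e} {R}" if e: "e \<in> D" for e
    proof -
      have "e \<noteq> f0" using f0 e less.prems by auto
      then obtain R where R: "is_path V E R" "\<And>p i j. inner_segment p i j \<Longrightarrow>
          (e \<in> between p i j) \<noteq> (f0 \<in> between p i j) \<Longrightarrow> (p ! i \<in> set R) \<noteq> (p ! j \<in> set R)"
        using connector_exists[of e f0] e DE f0 by blast
      then show ?thesis using between_mid_edges f0 unfolding mid_separates_def by blast
    qed
    then obtain R where R: "\<And>e. e \<in> D \<Longrightarrow> is_path V E (R e) \<and> mid_separates {e} {R e}" by metis
    have "card (R ` D) \<le> card D" by (rule card_image_le[OF fin])
    moreover have "card D \<le> card D div 2 + 1" using False by linarith
    moreover have "mid_separates D (R ` D)"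
      using R unfolding mid_separates_def by fast
    ultimately show ?thesis using R fin by (intro exI[of _ "R ` D"]) auto
  next
    case True
    obtain e f where ef: "e \<in> D" "f \<in> D" "e \<noteq> f"
      "\<And>p i j. inner_segment p i j \<Longrightarrow> e \<in> between p i j \<Longrightarrow> f \<in> between p i j \<Longrightarrow>
         \<exists>g \<in> D - {e, f}. g \<in> between p i j"
      using spread_pair_exists[OF less.prems True] by blast
    have c: "card (D - {e, f}) = card D - 2" using ef fin by (simp add: card_Diff_subset)
    moreover have "D - {e, f} \<subseteq> mid_edges" using less.prems by blast
    ultimately obtain G where G: "finite G" "card G \<le> card (D - {e, f}) div 2 + 1"
      "\<forall>p\<in>G. is_path V E p" "mid_separates (D - {e, f}) G"
      using less.hyps[of "D - {e, f}"] True by auto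
    obtain R where R: "is_path V E R" "\<And>p i j. inner_segment p i j \<Longrightarrow>
        (e \<in> between p i j) \<noteq> (f \<in> between p i j) \<Longrightarrow> (p ! i \<in> set R) \<noteq> (p ! j \<in> set R)"
      using connector_exists[of e f] ef DE by blast
    have "mid_separates D (insert R G)"
      unfolding mid_separates_def
    proof (intro allI impI, elim conjE)
      fix p i j assume s: "inner_segment p i j" and d: "D \<inter> between p i j \<noteq> {}"
      show "\<exists>g\<in>insert R G. (p ! i \<in> set g) \<noteq> (p ! j \<in> set g)"
      \<comment> \<open>If the smaller family is of no help, the segment contains exactly one of
        \<open>e\<close> and \<open>f\<close>: both together would bring in a third edge of
        \<open>D\<close>.\<close>
      proof (cases "(D - {e, f}) \<inter> between p i j = {}")
        case True
        then have "(e \<in> between p i j) \<noteq> (f \<in> between p i j)" using ef(4)[OF s] d by blast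
        then show ?thesis using R(2)[OF s] by blast
      next
        case False
        then show ?thesis using G(4) s unfolding mid_separates_def by blast
      qed
    qed
    moreover have "card (insert R G) \<le> card D div 2 + 1"
      using G(1,2) c True card_insert_le_m1[of _ G R] by (simp add: card_insert_if)
    ultimately show ?thesis using G R by (intro exI[of _ "insert R G"]) auto
  qed
qed

end

section \<open>The upper bound\<close>

definition distinguishes :: "'a list set \<Rightarrow> 'a \<Rightarrow> 'a \<Rightarrow> bool" where
  "distinguishes F u v \<longleftrightarrow> (\<exists>p\<in>F. (u \<in> set p) \<noteq> (v \<in> set p))"

lemma distinguishes_sym: "distinguishes F u v \<Longrightarrow> distinguishes F v u"
  by (auto simp: distinguishes_def)

lemma distinguishes_mono: "distinguishes F u v \<Longrightarrow> F \<subseteq> F' \<Longrightarrow> distinguishes F' u v"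
  by (auto simp: distinguishes_def)

lemma distinguishesI: "p \<in> F \<Longrightarrow> u \<in> set p \<Longrightarrow> v \<notin> set p \<Longrightarrow> distinguishes F u v"
  by (auto simp: distinguishes_def)

lemma sp_star_le_card:
  assumes "finite F" "\<And>p. p \<in> F \<Longrightarrow> is_path V E p"
    and "\<And>u v. u \<in> V \<Longrightarrow> v \<in> V \<Longrightarrow> u \<noteq> v \<Longrightarrow> distinguishes F u v"
    and "\<And>v. v \<in> V \<Longrightarrow> \<exists>p\<in>F. v \<in> set p"
  shows "sp_star V E (Vertex ` V) \<le> card F"
proof -
  have "separates F (Vertex ` V)"
    using assms(3) by (fastforce simp: separates_def paths_through_def distinguishes_def)
  moreover have "covers F (Vertex ` V)"
    using assms(4) by (fastforce simp: covers_def paths_through_def)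
  ultimately show ?thesis
    unfolding sp_star_def using assms(1,2) by (intro Least_le) blast
qed

context tree
begin

text \<open>Three leaves are served by two paths: the middle one lies on both.\<close>

lemma leaf_family_exists:
  "finite X \<Longrightarrow> (\<And>x. x \<in> X \<Longrightarrow> leaf E x) \<Longrightarrow>
    \<exists>H. finite H \<and> card H \<le> (2 * card X + 2) div 3 \<and> (\<forall>p\<in>H. is_path V E p) \<and>
      (\<forall>p\<in>H. \<forall>l\<in>set p. leaf E l \<longrightarrow> l \<in> X) \<and> (\<forall>x\<in>X. \<exists>p\<in>H. x \<in> set p) \<and>
      (\<forall>x\<in>X. \<forall>y\<in>X. x \<noteq> y \<longrightarrow> distinguishes H x y)"
proof (induction "card X" arbitrary: X rule: less_induct)
  case less
  show ?case
  proof (cases "3 \<le> card X")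
    case False
    \<comment> \<open>Zero, one or two leaves get one path each, exactly the value of
      \<open>(2 * n + 2) div 3\<close> for \<open>n\<close> equal to 0, 1 or 2.\<close>
    have "card ((\<lambda>x. [x]) ` X) \<le> card X" by (rule card_image_le[OF less.prems(1)])
    also have "\<dots> \<le> (2 * card X + 2) div 3" using False by linarith
    finally show ?thesis
      using less.prems leaf_in_V
      by (intro exI[of _ "(\<lambda>x. [x]) ` X"]) (auto simp: is_path_def distinguishes_def)
  next
    case True
    obtain T where T: "T \<subseteq> X" "card T = 3" using True obtain_subset_with_card_n by metis
    then obtain x y z where xyz: "T = {x, y, z}" "x \<noteq> y" "x \<noteq> z" "y \<noteq> z" by (auto simp: card_3_iff)
    have c: "card (X - T) = card X - 3"
      using T less.prems(1) by (simp add: card_Diff_subset finite_subset)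
    obtain H where H: "finite H" "card H \<le> (2 * card (X - T) + 2) div 3" "\<forall>p\<in>H. is_path V E p"
      "\<forall>p\<in>H. \<forall>l\<in>set p. leaf E l \<longrightarrow> l \<in> X - T" "\<forall>x\<in>X - T. \<exists>p\<in>H. x \<in> set p"
      "\<forall>x\<in>X - T. \<forall>y\<in>X - T. x \<noteq> y \<longrightarrow> distinguishes H x y"
      using less.hyps[of "X - T"] less.prems c True by auto
    have l: "leaf E x" "leaf E y" "leaf E z" using T xyz less.prems(2) by auto
    note p = tpath[OF leaf_in_V[OF l(1)] leaf_in_V[OF l(2)]]
    note q = tpath[OF leaf_in_V[OF l(2)] leaf_in_V[OF l(3)]]
    let ?p = "tpath x y" and ?q = "tpath y z"
    let ?H = "insert ?p (insert ?q H)"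
    have lp: "l \<in> {x, y}" if "l \<in> set ?p" "leaf E l" for l using leaf_on_path_end[OF p(1) that] p by auto
    have lq: "l \<in> {y, z}" if "l \<in> set ?q" "leaf E l" for l using leaf_on_path_end[OF q(1) that] q by auto
    have "card ?H \<le> card H + 2" by (simp add: card_insert_if H(1))
    also have "\<dots> \<le> (2 * card X + 2) div 3" using H(2) c True by linarith
    finally have "card ?H \<le> (2 * card X + 2) div 3" .
    moreover have "distinguishes ?H u v" if uv: "u \<in> X" "v \<in> X" "u \<noteq> v" for u v
    proof -
      \<comment> \<open>The condition on \<open>y\<close> fixes an orientation: \<open>y\<close>
        lies on both paths, so within \<open>T\<close> it is compared from the side of
        \<open>x\<close> or \<open>z\<close>, and the reverse pair follows by symmetry.\<close>
      have *: "distinguishes ?H u v" if "u \<in> T" "v \<in> X" "u \<noteq> v" "u = y \<longrightarrow> v \<notin> T" for u v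
      proof -
        have lv: "leaf E v" using that less.prems by blast
        show ?thesis
        proof (cases "u = z")
          case True
          show ?thesis
          proof (cases "v = y")
            case True
            have "z \<notin> set ?p" using lp l(3) xyz by auto
            then show ?thesis using True \<open>u = z\<close> p(5) by (auto simp: distinguishes_def)
          next
            case False
            then have "v \<notin> set ?q" using lq lv that True by auto
            then show ?thesis using True q(5) by (auto simp: distinguishes_def)
          qed
        next
          case False
          show ?thesis
          proof (cases "v = y")
            case True
            then have "u = x" using that False xyz by auto
            moreover have "x \<notin> set ?q" using lq l(1) xyz by auto
            ultimately show ?thesis using True q(4) by (auto simp: distinguishes_def)
          next
            case vy: False
            then have "v \<notin> set ?p \<and> u \<in> set ?p"
              using lp lv that False p(4,5) xyz by auto
            then show ?thesis by (auto simp: distinguishes_def)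
          qed
        qed
      qed
      show ?thesis
      proof (cases "u \<in> T \<or> v \<in> T")
        case False
        then show ?thesis using H(6) uv distinguishes_mono[of H u v ?H] by blast
      next
        case True
        show ?thesis
        proof (cases "u \<in> T \<and> (u = y \<longrightarrow> v \<notin> T)")
          case True
          then show ?thesis using * uv by simp
        next
          case False
          then have "distinguishes ?H v u" using * uv \<open>u \<in> T \<or> v \<in> T\<close> by auto
          then show ?thesis by (rule distinguishes_sym)
        qed
      qed
    qed
    moreover have "\<exists>p\<in>?H. u \<in> set p" if "u \<in> X" for u
    proof (cases "u \<in> T")
      case True
      then show ?thesis using p(4,5) q(5) unfolding xyz(1) by auto
    next
      case False
      then show ?thesis using that H(5) by simp
    qed
    moreover have "l \<in> X" if "p \<in> ?H" "l \<in> set p" "leaf E l" for p l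
    proof -
      have "l \<in> T \<or> l \<in> X - T" using that H(4) lp lq unfolding xyz(1) by blast
      then show ?thesis using T(1) by blast
    qed
    moreover have "finite ?H" "\<forall>p\<in>?H. is_path V E p" using H p(1) q(1) by auto
    ultimately show ?thesis by (intro exI[of _ ?H]) auto
  qed
qed

lemma no_supports:
  assumes "supports = {}"
  shows "\<exists>r. V = {r}"
proof -
  obtain r where r: "r \<in> V" using tree by (auto simp: is_tree_def)
  have "v = r" if v: "v \<in> V" for v
  proof (rule ccontr)
    assume "v \<noteq> r"
    then obtain y where "{r, y} \<in> E" using branch_exists r v by metis
    then show False using assms branch_contains_support[of r y] by (auto simp: supports_def)
  qed
  then show ?thesis using r by blast
qed

lemma neighbour_exists:
  assumes "supports \<noteq> {}" "v \<in> V"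
  shows "\<exists>y. {v, y} \<in> E"
proof -
  obtain s l where s: "{s, l} \<in> E" using assms(1) by (auto simp: supports_def)
  then have "s \<in> V" using edgeD by blast
  show ?thesis
  proof (cases "v = s")
    case True then show ?thesis using s by blast
  next
    case False
    then show ?thesis using branch_exists[OF assms(2) \<open>s \<in> V\<close>] by metis
  qed
qed

lemma nbr_of_nonsupport: "v \<notin> supports \<Longrightarrow> {v, y} \<in> E \<Longrightarrow> \<not> leaf E y"
  by (auto simp: supports_def)

lemma support_of_leaf_unique: "leaf E l \<Longrightarrow> {w, l} \<in> E \<Longrightarrow> {w', l} \<in> E \<Longrightarrow> w = w'"
  using leaf_nbr_unique edge_sym by blast

lemma support_on_path:
  assumes p: "is_path V E p" and l: "leaf E l" "{w, l} \<in> E" "l \<in> set p" "v \<in> set p" "v \<noteq> l"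
  shows "w \<in> set p"
proof -
  have V: "l \<in> V" "v \<in> V" using p l by (auto simp: is_path_def)
  obtain y where y: "{l, y} \<in> E" "v \<in> branch l y" using branch_exists[OF V l(5)] by blast
  have "y = w" using leaf_nbr_unique[OF l(1) y(1) edge_sym[OF l(2)]] .
  then show ?thesis
    using path_crosses_edge[OF y(1) p l(4,3) y(2) source_notin_branch[OF y(1)]] by simp
qed

end

section \<open>The core family: two paths for each support\<close>

locale bushy_tree = tree +
  assumes bunches_ge_3: "B \<in> bunches V E \<Longrightarrow> 3 \<le> bunch_size E B"
begin

text \<open>Deleting the interior edges leaves \<open>w\<close> joined only to its leaves if
  \<open>w\<close> is no leaf, so the bunch of \<open>w\<close> is the star of \<open>w\<close> with
  its leaves. If \<open>w\<close> were a leaf itself, its bunch would be a single edge with only two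
  leaves.\<close>

lemma support_leaves:
  assumes w: "w \<in> supports"
  shows "\<not> leaf E w" "3 \<le> card {l. leaf E l \<and> {w, l} \<in> E}"
proof -
  obtain l where l: "leaf E l" "{w, l} \<in> E" using w by (auto simp: supports_def)
  let ?E = "E - interior_edges E"
  let ?N = "{l. leaf E l \<and> {w, l} \<in> E}"
  define B where "B = {v \<in> V. joined V ?E w v}"
  have V: "w \<in> V" "l \<in> V" using edgeD[OF l(2)] by auto
  have e: "{w, l} \<in> ?E" using l by (auto simp: interior_edges_def)
  then have "w \<in> B" "l \<in> B" using V by (auto simp: B_def joined_refl joined_edge)
  then have "{w, l} \<subseteq> B" by simp
  moreover have "B \<in> components V ?E" unfolding components_def B_def using V(1) by blast
  ultimately have "B \<in> bunches V E" unfolding bunches_def using e by blast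
  then have three: "3 \<le> card {v \<in> B. leaf E v}" using bunches_ge_3 by (simp add: bunch_size_def)
  show nl: "\<not> leaf E w"
  proof
    assume lw: "leaf E w"
    have "v \<in> {w, l}" if v: "joined V ?E w v" for v
      using v
    proof (rule joined_induct)
      fix x y assume "x \<in> {w, l}" "{x, y} \<in> ?E"
      then show "y \<in> {w, l}"
        using leaf_nbr_unique[OF lw _ l(2)] leaf_nbr_unique[OF l(1) _ edge_sym[OF l(2)]] by auto
    qed simp
    then have "{v \<in> B. leaf E v} \<subseteq> {w, l}" by (auto simp: B_def)
    then have "card {v \<in> B. leaf E v} \<le> card {w, l}" by (intro card_mono) auto
    then show False using three by (simp add: card_insert_if split: if_splits)
  qed
  have "v \<in> insert w ?N" if v: "joined V ?E w v" for v
    using v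
  proof (rule joined_induct)
    fix x y assume h: "x \<in> insert w ?N" "{x, y} \<in> ?E"
    show "y \<in> insert w ?N"
    proof (cases "x = w")
      case True
      then show ?thesis using h nl by (auto simp: interior_edges_def)
    next
      case False
      then have "leaf E x" "{x, w} \<in> E" "{x, y} \<in> E" using h by (auto simp: insert_commute)
      then show ?thesis using leaf_nbr_unique[of x y w] by simp
    qed
  qed simp
  then have "{v \<in> B. leaf E v} \<subseteq> ?N" using nl by (auto simp: B_def)
  moreover have "finite ?N" using finite_V leaf_in_V by (auto intro: finite_subset[of _ V])
  ultimately show "3 \<le> card ?N" using three card_mono order_trans by blast
qed

lemma three_leaves_exist:
  "\<exists>a b c. \<forall>w\<in>supports. {a w, b w, c w} \<subseteq> {l. leaf E l \<and> {w, l} \<in> E} \<and>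
     a w \<noteq> b w \<and> b w \<noteq> c w \<and> a w \<noteq> c w"
proof -
  define P where "P w x y z \<longleftrightarrow> {x, y, z} \<subseteq> {l. leaf E l \<and> {w, l} \<in> E} \<and>
    x \<noteq> y \<and> y \<noteq> z \<and> x \<noteq> z" for w x y z
  have "\<exists>x y z. P w x y z" if w: "w \<in> supports" for w
  proof -
    obtain T where T: "T \<subseteq> {l. leaf E l \<and> {w, l} \<in> E}" "card T = 3"
      using obtain_subset_with_card_n[OF support_leaves(2)[OF w]] .
    then obtain x y z where "T = {x, y, z}" "x \<noteq> y" "x \<noteq> z" "y \<noteq> z" by (auto simp: card_3_iff)
    then have "P w x y z" using T unfolding P_def by simp
    then show ?thesis by blast
  qed
  then have "\<exists>a b c. \<forall>w\<in>supports. P w (a w) (b w) (c w)" by metis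
  then show ?thesis unfolding P_def .
qed

end

text \<open>The three leaves at a support play different roles: \<open>a w\<close> lies only on the
  local path, \<open>b w\<close> only on the ring path arriving at \<open>w\<close>, and
  \<open>c w\<close> on the local path and on the ring path departing from \<open>w\<close>.\<close>

locale ring_family = bushy_tree +
  fixes a b c f :: "'a \<Rightarrow> 'a"
  assumes abc: "w \<in> supports \<Longrightarrow> {a w, b w, c w} \<subseteq> {l. leaf E l \<and> {w, l} \<in> E}"
    and abc_distinct: "w \<in> supports \<Longrightarrow> a w \<noteq> b w \<and> b w \<noteq> c w \<and> a w \<noteq> c w"
    and ring: "ring supports f"
begin

lemma leaf_abc:
  assumes "w \<in> supports"
  shows "leaf E (a w)" "leaf E (b w)" "leaf E (c w)"
    "{w, a w} \<in> E" "{w, b w} \<in> E" "{w, c w} \<in> E" "\<not> leaf E w"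
    "a w \<noteq> b w" "b w \<noteq> c w" "a w \<noteq> c w" "a w \<in> V" "b w \<in> V" "c w \<in> V" "f w \<in> supports"
  using abc[OF assms] abc_distinct[OF assms] leaf_in_V support_leaves(1)[OF assms] ring_image[OF ring] assms
  by auto

lemma abc_owner:
  assumes "w \<in> supports" "w' \<in> supports" "x \<in> {a w, b w, c w}" "x \<in> {a w', b w', c w'}"
  shows "w = w'"
  using abc[OF assms(1)] abc[OF assms(2)] assms(3,4) support_of_leaf_unique[of x w w'] by blast

definition local_path :: "'a \<Rightarrow> 'a list" where
  "local_path w = [a w, w, c w]"

definition ring_path :: "'a \<Rightarrow> 'a list" where
  "ring_path w = tpath (c w) (b (f w))"

definition core_family :: "'a list set" where
  "core_family = local_path ` supports \<union> ring_path ` supports"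

definition core_leaves :: "'a set" where
  "core_leaves = a ` supports \<union> b ` supports \<union> c ` supports"

lemma local_path:
  assumes "w \<in> supports"
  shows "is_path V E (local_path w)"
  using leaf_abc[OF assms] supports_in_V[OF assms]
  by (auto simp: is_path_def local_path_def nth_Cons insert_commute split: nat.splits)

lemma ring_path:
  assumes w: "w \<in> supports"
  shows "is_path V E (ring_path w)" "hd (ring_path w) = c w" "last (ring_path w) = b (f w)"
    "c w \<in> set (ring_path w)" "b (f w) \<in> set (ring_path w)"
  using tpath[OF leaf_abc(13)[OF w] leaf_abc(12)[OF leaf_abc(14)[OF w]]] by (simp_all add: ring_path_def)

lemma c_neq_b:
  assumes "w \<in> supports" "w' \<in> supports"
  shows "c w \<noteq> b w'"
proof
  assume h: "c w = b w'"
  then have "w = w'" using abc_owner[OF assms, of "c w"] by simp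
  then show False using leaf_abc(9)[OF assms(1)] h by simp
qed

lemma ring_path_supports:
  assumes w: "w \<in> supports"
  shows "w \<in> set (ring_path w)" "f w \<in> set (ring_path w)"
proof -
  have fw: "f w \<in> supports" using leaf_abc(14)[OF w] .
  note r = ring_path[OF w]
  show "w \<in> set (ring_path w)"
    by (rule support_on_path[OF r(1) leaf_abc(3,6)[OF w] r(4,5)]) (use c_neq_b[OF w fw] in auto)
  show "f w \<in> set (ring_path w)"
    by (rule support_on_path[OF r(1) leaf_abc(2,5)[OF fw] r(5,4)]) (use c_neq_b[OF w fw] in auto)
qed

lemma leaf_on_ring_path:
  assumes "w \<in> supports" "l \<in> set (ring_path w)" "leaf E l"
  shows "l = c w \<or> l = b (f w)"
  using leaf_on_path_end[OF ring_path(1)[OF assms(1)] assms(2,3)] ring_path[OF assms(1)] by auto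

lemma leaf_on_local_path:
  assumes "w \<in> supports" "l \<in> set (local_path w)" "leaf E l"
  shows "l = a w \<or> l = c w"
  using assms leaf_abc(7)[OF assms(1)] by (auto simp: local_path_def)

lemma nonleaf_on_local_path:
  assumes "w \<in> supports" "\<not> leaf E v"
  shows "v \<in> set (local_path w) \<longleftrightarrow> v = w"
  using assms leaf_abc(1,3)[OF assms(1)] by (auto simp: local_path_def)

lemma in_local_path: "w \<in> set (local_path w)" "a w \<in> set (local_path w)" "c w \<in> set (local_path w)"
  by (auto simp: local_path_def)

lemma in_core_family:
  "w \<in> supports \<Longrightarrow> local_path w \<in> core_family" "w \<in> supports \<Longrightarrow> ring_path w \<in> core_family"
  by (auto simp: core_family_def)

lemma ring_inj:
  assumes "u \<in> supports" "w \<in> supports" "f u = f w"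
  shows "u = w"
proof -
  have "inj_on f supports"
    using ring_image[OF ring] finite_supports by (intro eq_card_imp_inj_on) auto
  then show ?thesis using assms by (auto dest: inj_onD)
qed

lemma ring_predecessor: "w \<in> supports \<Longrightarrow> \<exists>u\<in>supports. f u = w"
  using ring_image[OF ring] by (metis imageE)

lemma b_on_ring_path:
  assumes "w \<in> supports" "u \<in> supports" "b w \<in> set (ring_path u)"
  shows "f u = w"
proof -
  have fu: "f u \<in> supports" using leaf_abc(14)[OF assms(2)] .
  have "b w = b (f u)"
    using leaf_on_ring_path[OF assms(2,3) leaf_abc(2)[OF assms(1)]] c_neq_b[OF assms(2,1)] by auto
  then show ?thesis using abc_owner[OF assms(1) fu, of "b w"] by simp
qed

lemma a_not_on_ring_path:
  assumes w: "w \<in> supports" and u: "u \<in> supports"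
  shows "a w \<notin> set (ring_path u)"
proof
  assume h: "a w \<in> set (ring_path u)"
  have fu: "f u \<in> supports" using leaf_abc(14)[OF u] .
  from leaf_on_ring_path[OF u h leaf_abc(1)[OF w]] show False
  proof
    assume e: "a w = c u"
    then have "w = u" using abc_owner[OF w u, of "a w"] by simp
    then show False using e leaf_abc(10)[OF w] by simp
  next
    assume e: "a w = b (f u)"
    then have "w = f u" using abc_owner[OF w fu, of "a w"] by simp
    then show False using e leaf_abc(8)[OF w] by simp
  qed
qed

text \<open>The local path of \<open>w\<close> singles out \<open>a w\<close> and
  \<open>c w\<close>, and the ring path departing from \<open>w\<close> separates these two. Two
  leaves of type \<open>b\<close> end different ring paths.\<close>

lemma core_leaf_pairs:
  assumes "x \<in> core_leaves" "y \<in> core_leaves" "x \<noteq> y"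
  shows "distinguishes core_family x y"
proof -
  have leaf: "leaf E z" if "z \<in> core_leaves" for z
    using that leaf_abc(1-3) by (auto simp: core_leaves_def)
  have ac: "distinguishes core_family x y"
    if w: "w \<in> supports" and x: "x = a w \<or> x = c w" and y: "y \<in> core_leaves" "x \<noteq> y" for w x y
  proof (cases "y = a w \<or> y = c w")
    case False
    then have "y \<notin> set (local_path w)" using leaf_on_local_path[OF w _ leaf[OF y(1)]] by blast
    then show ?thesis
      using x in_local_path[of w] in_core_family(1)[OF w] by (auto intro: distinguishesI)
  next
    case True
    then have "distinguishes core_family (c w) (a w)"
      using ring_path(4)[OF w] a_not_on_ring_path[OF w w] in_core_family(2)[OF w]
      by (auto intro: distinguishesI)
    then show ?thesis using True x y(2) distinguishes_sym by metis
  qed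
  consider w where "w \<in> supports" "x = a w \<or> x = c w" | w where "w \<in> supports" "y = a w \<or> y = c w"
    | w w' where "w \<in> supports" "w' \<in> supports" "x = b w" "y = b w'"
    using assms(1,2) by (auto simp: core_leaves_def)
  then show ?thesis
  proof cases
    case 1
    then show ?thesis using ac assms by blast
  next
    case 2
    then show ?thesis using ac[OF 2 assms(1)] assms(3) distinguishes_sym by metis
  next
    case 3
    obtain u where u: "u \<in> supports" "f u = w" using ring_predecessor 3 by blast
    have "b w' \<notin> set (ring_path u)" using b_on_ring_path[OF 3(2) u(1)] u(2) 3 assms(3) by auto
    then show ?thesis
      using ring_path(5)[OF u(1)] u 3 in_core_family(2)[OF u(1)] by (auto intro: distinguishesI)
  qed
qed

text \<open>\<open>{x, y}\<close> is not a leaf edge, so a leaf and its support stay on the same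
  side. Whether a ring path crosses the edge can therefore be read off from \<open>w\<close> and
  \<open>f w\<close>.\<close>

lemma leaf_in_branch_iff:
  assumes e: "{x, y} \<in> E" "\<not> leaf E x" "\<not> leaf E y" and w: "w \<in> supports"
  shows "c w \<in> branch x y \<longleftrightarrow> w \<in> branch x y" "b w \<in> branch x y \<longleftrightarrow> w \<in> branch x y"
proof -
  have "l \<in> branch x y \<longleftrightarrow> w \<in> branch x y" if l: "leaf E l" "{w, l} \<in> E" for l
    using branch_edge[OF e(1) l(2)] branch_edge[OF e(1) edge_sym[OF l(2)]] l(1) e(2,3) by blast
  then show "c w \<in> branch x y \<longleftrightarrow> w \<in> branch x y" "b w \<in> branch x y \<longleftrightarrow> w \<in> branch x y"
    using leaf_abc[OF w] by blast+
qed

lemma ring_path_crosses: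
  assumes e: "{x, y} \<in> E" "\<not> leaf E x" "\<not> leaf E y" and w: "w \<in> supports"
    and "w \<in> branch x y" "f w \<notin> branch x y"
  shows "x \<in> set (ring_path w)" "y \<in> set (ring_path w)"
proof -
  have "x \<in> set (ring_path w) \<and> y \<in> set (ring_path w)"
    using path_crosses_edge[OF e(1) ring_path(1,4,5)[OF w]]
      leaf_in_branch_iff(1)[OF e w] leaf_in_branch_iff(2)[OF e leaf_abc(14)[OF w]] assms(5,6) by simp
  then show "x \<in> set (ring_path w)" "y \<in> set (ring_path w)" by auto
qed

lemma ring_path_avoids:
  assumes e: "{x, y} \<in> E" "\<not> leaf E x" "\<not> leaf E y" and w: "w \<in> supports"
    and "w \<notin> branch x y" "f w \<notin> branch x y" and v: "v \<in> set (ring_path w)"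
  shows "v \<notin> branch x y"
  using path_avoids_branch[OF e(1) ring_path(1)[OF w] _ _ v] ring_path(2,3)[OF w]
    leaf_in_branch_iff(1)[OF e w] leaf_in_branch_iff(2)[OF e leaf_abc(14)[OF w]] assms(5,6) by simp

lemma ring_path_within:
  assumes e: "{x, y} \<in> E" "\<not> leaf E x" "\<not> leaf E y" and w: "w \<in> supports"
    and "w \<in> branch x y" "f w \<in> branch x y" and v: "v \<in> set (ring_path w)"
  shows "v \<in> branch x y"
  using path_within_branch[OF e(1) ring_path(1)[OF w] _ _ v] ring_path(2,3)[OF w]
    leaf_in_branch_iff(1)[OF e w] leaf_in_branch_iff(2)[OF e leaf_abc(14)[OF w]] assms(5,6) by simp

lemma exit_from_branch:
  assumes e: "{x, y} \<in> E" "\<not> leaf E x" "\<not> leaf E y"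
  obtains s where "s \<in> supports" "s \<in> branch x y" "f s \<notin> branch x y"
proof -
  obtain s where s: "s \<in> supports" "s \<in> branch x y" using branch_contains_support e by blast
  obtain t where t: "t \<in> supports" "t \<in> branch y x"
    using branch_contains_support[OF edge_sym[OF e(1)] e(2)] by blast
  have "t \<notin> branch x y" using t branch_opposite[OF e(1)] by blast
  then show ?thesis using ring_exit[OF ring s t(1)] that by blast
qed

text \<open>Both sides of any edge at \<open>v\<close> contain supports, so the ring crosses the
  edge in both directions. The two jumps start on opposite sides and hence differ.\<close>

lemma two_ring_paths:
  assumes v: "v \<in> V" "v \<notin> supports" "\<not> leaf E v" and "supports \<noteq> {}"
  obtains s t where "s \<in> supports" "t \<in> supports" "s \<noteq> t"
    "v \<in> set (ring_path s)" "v \<in> set (ring_path t)"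
proof -
  obtain y where y: "{v, y} \<in> E" using neighbour_exists assms by blast
  have ny: "\<not> leaf E y" using nbr_of_nonsupport v y by blast
  obtain s where s: "s \<in> supports" "s \<in> branch v y" "f s \<notin> branch v y"
    using exit_from_branch[OF y v(3) ny] by blast
  obtain t where t: "t \<in> supports" "t \<in> branch y v" "f t \<notin> branch y v"
    using exit_from_branch[OF edge_sym[OF y] ny v(3)] by blast
  have "s \<noteq> t" using s t branch_opposite[OF y] by blast
  then show ?thesis
    using that[OF s(1) t(1)] ring_path_crosses[OF y v(3) ny s]
      ring_path_crosses[OF edge_sym[OF y] ny v(3) t] by blast
qed

text \<open>The close pairs are a support with its own leaves: \<open>a w\<close> is on no ring
  path, while \<open>c w\<close> misses the ring path arriving at \<open>w\<close>. The latter
  differs from the departing one because \<open>f w \<noteq> w\<close>. Finally \<open>b w\<close>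
  is on one ring path only, whereas a nonleaf that is no support is on two.\<close>

lemma core_leaf_vs_nonleaf:
  assumes x: "x \<in> core_leaves" and v: "v \<in> V" "\<not> leaf E v" and two: "\<And>w. w \<in> supports \<Longrightarrow> f w \<noteq> w"
  shows "distinguishes core_family x v"
proof -
  consider w where "w \<in> supports" "x = a w" | w where "w \<in> supports" "x = c w"
    | w where "w \<in> supports" "x = b w"
    using x by (auto simp: core_leaves_def)
  then show ?thesis
  proof cases
    case 1
    show ?thesis
    proof (cases "v = w")
      case True
      then show ?thesis
        using ring_path_supports(1)[OF 1(1)] a_not_on_ring_path[OF 1(1,1)] in_core_family(2)[OF 1(1)] 1(2)
        by (auto simp: distinguishes_def)
    next
      case False
      then show ?thesis
        using nonleaf_on_local_path[OF 1(1) v(2)] in_local_path[of w] in_core_family(1)[OF 1(1)] 1(2)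
        by (auto intro: distinguishesI)
    qed
  next
    case 2
    show ?thesis
    proof (cases "v = w")
      case True
      obtain u where u: "u \<in> supports" "f u = w" using ring_predecessor 2 by blast
      have "c w \<notin> set (ring_path u)"
      proof
        assume "c w \<in> set (ring_path u)"
        then have "c w = c u \<or> c w = b w"
          using leaf_on_ring_path[OF u(1) _ leaf_abc(3)[OF 2(1)]] u(2) by simp
        then have "c w = c u" using leaf_abc(9)[OF 2(1)] by auto
        then have "w = u" using abc_owner[OF 2(1) u(1), of "c w"] by simp
        then show False using two u by blast
      qed
      then show ?thesis
        using ring_path_supports(2)[OF u(1)] in_core_family(2)[OF u(1)] u(2) 2(2) True
        by (auto simp: distinguishes_def)
    next
      case False
      then show ?thesis
        using nonleaf_on_local_path[OF 2(1) v(2)] in_local_path[of w] in_core_family(1)[OF 2(1)] 2(2)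
        by (auto intro: distinguishesI)
    qed
  next
    case 3
    show ?thesis
    proof (cases "v \<in> supports")
      case True
      have "b w \<notin> set (local_path v)"
      proof
        assume h: "b w \<in> set (local_path v)"
        then have "b w = a v \<or> b w = c v" using leaf_on_local_path[OF True h] leaf_abc(2)[OF 3(1)] by simp
        moreover from this have "w = v" using abc_owner[OF 3(1) True, of "b w"] by auto
        ultimately show False using leaf_abc(8,9)[OF 3(1)] by auto
      qed
      then show ?thesis
        using in_local_path(1)[of v] in_core_family(1)[OF True] 3(2) by (auto simp: distinguishes_def)
    next
      case False
      obtain s t where st: "s \<in> supports" "t \<in> supports" "s \<noteq> t"
        "v \<in> set (ring_path s)" "v \<in> set (ring_path t)"
        using two_ring_paths[OF v(1) False v(2)] 3(1) by blast
      then have "b w \<notin> set (ring_path s) \<or> b w \<notin> set (ring_path t)"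
        using b_on_ring_path[OF 3(1)] ring_inj by metis
      then show ?thesis using st in_core_family(2) 3(2) by (auto simp: distinguishes_def)
    qed
  qed
qed

text \<open>Suppose every ring path through \<open>u\<close> contains \<open>v\<close>, which lies
  beyond \<open>x\<close>. A jump out of any other branch at \<open>u\<close> passes
  \<open>u\<close>, hence reaches \<open>v\<close>, hence ends beyond \<open>x\<close>. Two such
  branches give two different exits from \<open>branch x u\<close>, where a ring has at most
  one.\<close>

lemma branching_distinguished:
  assumes u: "u \<in> V" "u \<notin> supports" "3 \<le> degree E u" and v: "v \<in> V" "v \<noteq> u"
  shows "distinguishes core_family u v"
proof (rule ccontr)
  assume "\<not> ?thesis"
  then have same: "v \<in> set (ring_path s)" if "s \<in> supports" "u \<in> set (ring_path s)" for s
    using that in_core_family(2) by (auto simp: distinguishes_def)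
  have nu: "\<not> leaf E u" using u by (simp add: leaf_def)
  obtain x where x: "{u, x} \<in> E" "v \<in> branch u x" using branch_exists[OF u(1) v] by blast
  have nx: "\<not> leaf E x" using nbr_of_nonsupport u x by blast
  have onward: "\<exists>s\<in>supports. s \<in> branch u y \<and> s \<in> branch x u \<and> f s \<notin> branch x u"
    if y: "{u, y} \<in> E" "y \<noteq> x" for y
  proof -
    have ny: "\<not> leaf E y" using nbr_of_nonsupport u y by blast
    obtain s where s: "s \<in> supports" "s \<in> branch u y" "f s \<notin> branch u y"
      using exit_from_branch[OF y(1) nu ny] by blast
    have "v \<in> set (ring_path s)" using same[OF s(1)] ring_path_crosses(1)[OF y(1) nu ny s] by blast
    moreover have sx: "s \<notin> branch u x" using branch_disjoint[OF y(1) x(1) s(2)] y(2) by blast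
    ultimately have "f s \<in> branch u x" using ring_path_avoids[OF x(1) nu nx s(1) sx] x(2) by blast
    then show ?thesis
      using s sx supports_in_V branch_opposite[OF x(1)] by blast
  qed
  obtain y where y: "{u, y} \<in> E" "y \<noteq> x" using nbr_avoiding[of "{x}" u] u(3) by auto
  have "card {x, y} < degree E u" using u(3) y by auto
  then obtain y' where y': "{u, y'} \<in> E" "y' \<noteq> x" "y' \<noteq> y" using nbr_avoiding[of "{x, y}" u] by auto
  obtain s where s: "s \<in> supports" "s \<in> branch u y" "s \<in> branch x u" "f s \<notin> branch x u"
    using onward[OF y] by blast
  obtain t where t: "t \<in> supports" "t \<in> branch u y'" "t \<in> branch x u" "f t \<notin> branch x u"
    using onward[OF y'(1,2)] by blast
  have "s = t" using ring_exit_unique[OF ring edge_sym[OF x(1)] s(1,3,4) t(1,3,4)] .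
  then show False using branch_disjoint[OF y(1) y'(1) s(2)] t(2) y'(3) by blast
qed

text \<open>The region \<open>branch u x \<inter> branch v y\<close> holds some but not all
  supports, so a jump leaves it past \<open>u\<close> or past \<open>v\<close>. The corresponding
  ring path contains that vertex and stays on the near side of the other.\<close>

lemma support_between_distinguished:
  assumes u: "u \<notin> supports" "\<not> leaf E u" and v: "v \<notin> supports" "\<not> leaf E v"
    and x: "{u, x} \<in> E" "v \<in> branch u x" and y: "{v, y} \<in> E" "u \<in> branch v y"
    and t: "t \<in> supports" "t \<in> branch u x" "t \<in> branch v y"
  shows "distinguishes core_family u v"
proof -
  have nx: "\<not> leaf E x" and ny: "\<not> leaf E y" using nbr_of_nonsupport u v x y by blast+
  obtain z where z: "{u, z} \<in> E" "z \<noteq> x" using nonleaf_other_nbr[OF edge_sym[OF x(1)] u(2)] by blast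
  have nz: "\<not> leaf E z" using nbr_of_nonsupport u z by blast
  \<comment> \<open>A support beyond \<open>u\<close>, showing that the region between
    \<open>u\<close> and \<open>v\<close> does not contain all supports.\<close>
  obtain r where r: "r \<in> supports" "r \<in> branch u z" using branch_contains_support[OF z(1) nz] by blast
  have "r \<notin> branch u x" using branch_disjoint[OF z(1) x(1) r(2)] z(2) by blast
  then obtain s where s: "s \<in> supports" "s \<in> branch u x" "s \<in> branch v y"
    "f s \<notin> branch u x \<or> f s \<notin> branch v y"
    using ring_exit[OF ring t(1) _ r(1), of "branch u x \<inter> branch v y"] t by blast
  have fs: "f s \<in> V" using leaf_abc(14)[OF s(1)] supports_in_V by blast
  have *: "distinguishes core_family u v"
    if u: "u \<notin> supports" "\<not> leaf E u" and v: "\<not> leaf E v" and nx: "\<not> leaf E x" and ny: "\<not> leaf E y"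
      and x: "{u, x} \<in> E" "v \<in> branch u x" and y: "{v, y} \<in> E" "u \<in> branch v y"
      and s: "s \<in> branch u x" "s \<in> branch v y" "f s \<notin> branch u x" for u v x y
  proof -
    have "v \<notin> branch x u" using x branch_opposite[OF x(1)] by blast
    then have "branch x u \<subseteq> branch v y" using branch_subset[OF edge_sym[OF x(1)] y(1)] y(2) by blast
    then have "f s \<in> branch v y" using branch_opposite[OF x(1)] s(3) fs by blast
    then have "v \<notin> set (ring_path s)"
      using ring_path_within[OF y(1) v ny \<open>s \<in> supports\<close> s(2)] source_notin_branch[OF y(1)] by blast
    moreover have "u \<in> set (ring_path s)"
      using ring_path_crosses(1)[OF x(1) u(2) nx \<open>s \<in> supports\<close> s(1,3)] .
    ultimately show ?thesis using in_core_family(2)[OF \<open>s \<in> supports\<close>] by (auto intro: distinguishesI)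
  qed
  from s(4) show ?thesis
  proof
    assume "f s \<notin> branch u x"
    then show ?thesis using *[OF u v(2) nx ny x y s(2,3)] by blast
  next
    assume "f s \<notin> branch v y"
    then show ?thesis using distinguishes_sym[OF *[OF v u(2) ny nx y x s(3,2)]] by simp
  qed
qed

text \<open>All vertices strictly between \<open>u\<close> and \<open>v\<close> have degree two: a
  third edge at such a vertex would lead into a branch lying wholly in the region between, and every
  such branch contains a support. So the path from \<open>u\<close> to \<open>v\<close> extends to a
  bare path.\<close>

lemma no_support_between_inner_segment:
  assumes u: "u \<in> V" "degree E u = 2" and v: "v \<in> V" "degree E v = 2" and uv: "u \<noteq> v"
    and x: "{u, x} \<in> E" "v \<in> branch u x" and y: "{v, y} \<in> E" "u \<in> branch v y"
    and none: "supports \<inter> branch u x \<inter> branch v y = {}"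
  obtains q i j where "inner_segment q i j" "q ! i = u" "q ! j = v"
proof -
  let ?p = "tpath u v"
  note p = tpath[OF u(1) v(1)]
  have ne: "?p \<noteq> []" and dist: "distinct ?p" using p(1) by (auto simp: is_path_def)
  have ends: "?p ! 0 = u" "?p ! (length ?p - 1) = v"
    using p(2,3) ne by (simp_all add: hd_conv_nth last_conv_nth)
  then have "length ?p - 1 \<noteq> 0" using uv by metis
  then have len: "2 \<le> length ?p" by linarith
  have deg: "degree E z = 2" if z: "z \<in> set ?p" for z
  proof (cases "z = u \<or> z = v")
    case True then show ?thesis using u v by blast
  next
    case False
    obtain k where k: "k < length ?p" "?p ! k = z" using z by (auto simp: in_set_conv_nth)
    have "k \<noteq> 0" "k \<noteq> length ?p - 1" using k ends False by metis+
    then obtain n where n: "k = Suc n" "Suc k < length ?p" using k(1) by (cases k) auto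
    have zu: "z \<in> branch u x"
    proof (rule ccontr)
      assume nz: "z \<notin> branch u x"
      have kl: "k \<le> length ?p - 1" "length ?p - 1 < length ?p" using n by auto
      have "?p ! k \<notin> branch u x" "?p ! (length ?p - 1) \<in> branch u x" using nz k(2) ends(2) x(2) by simp_all
      then obtain l where l: "k \<le> l" "l < length ?p - 1" "?p ! l = u"
        by (rule path_enters_branch[OF x(1) p(1) kl])
      then have "l < length ?p" "0 < length ?p" by auto
      then have "l = 0" using dist ends(1) l(3) nth_eq_iff_index_eq by metis
      then show False using l(1) n by simp
    qed
    have zv: "z \<in> branch v y"
    proof (rule ccontr)
      assume "z \<notin> branch v y"
      then obtain l where "l < k" "?p ! Suc l = v"
        using path_leaves_branch[OF y(1) p(1), of 0 k] k ends y(2) by auto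
      then have "Suc l < length ?p" "length ?p - 1 < length ?p" using k(1) by auto
      then have "Suc l = length ?p - 1"
        using dist ends(2) \<open>?p ! Suc l = v\<close> nth_eq_iff_index_eq by metis
      then show False using n \<open>l < k\<close> by simp
    qed
    have zS: "z \<notin> supports" using none zu zv by blast
    have e: "{?p ! n, z} \<in> E" "{z, ?p ! Suc k} \<in> E"
      using path_edge[OF p(1), of n] path_edge[OF p(1), of k] n k by auto
    have "?p ! 0 \<notin> branch (?p ! n) (?p ! Suc n)" using path_branch_side[OF p(1), of n 0] n ne by simp
    then have "u \<notin> branch (?p ! n) z" using n(1) k(2) ends(1) by simp
    then have ub: "u \<in> branch z (?p ! n)" using branch_cover[OF e(1) u(1)] by blast
    have "?p ! (length ?p - 1) \<in> branch (?p ! k) (?p ! Suc k)"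
      using path_branch_side[OF p(1), of k "length ?p - 1"] n ne by simp
    then have vb: "v \<in> branch z (?p ! Suc k)" using k(2) ends(2) by simp
    have "?p ! n \<noteq> ?p ! Suc k" using dist n by (simp add: nth_eq_iff_index_eq)
    then have "card {?p ! n, ?p ! Suc k} = 2" by simp
    moreover have "card {?p ! n, ?p ! Suc k} \<le> degree E z"
      using e by (intro degree_ge) (auto simp: insert_commute)
    moreover have "\<not> 3 \<le> degree E z"
    proof
      assume d3: "3 \<le> degree E z"
      then obtain g where g: "{z, g} \<in> E" "g \<noteq> ?p ! n" "g \<noteq> ?p ! Suc k"
        using nbr_avoiding[of "{?p ! n, ?p ! Suc k}" z] calculation(1) by auto
      have ug: "u \<notin> branch z g" using branch_disjoint[OF edge_sym[OF e(1)] g(1) ub] g(2) by blast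
      have vg: "v \<notin> branch z g" using branch_disjoint[OF e(2) g(1) vb] g(3) by blast
      have "g \<in> branch u x"
        using branch_edge[OF x(1) g(1) zu] ug target_in_branch[OF g(1)] by blast
      then have "branch z g \<subseteq> branch u x" using branch_subset[OF g(1) x(1) ug] by blast
      moreover have "g \<in> branch v y"
        using branch_edge[OF y(1) g(1) zv] vg target_in_branch[OF g(1)] by blast
      then have "branch z g \<subseteq> branch v y" using branch_subset[OF g(1) y(1) vg] by blast
      moreover obtain t where "t \<in> supports" "t \<in> branch z g"
        using branch_contains_support[OF g(1)] nbr_of_nonsupport[OF zS g(1)] by blast
      ultimately show False using none by blast
    qed
    ultimately show ?thesis by linarith
  qed
  obtain xs ys where q: "is_bare_path V E (xs @ ?p @ ys)"
    using extends_to_bare_path[OF p(1) len deg] by blast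
  \<comment> \<open>The ends of a bare path do not have degree two, but \<open>u\<close> and
    \<open>v\<close> do, so the extension is proper on both sides.\<close>
  have "xs \<noteq> []" using q u(2) p(2) ne by (auto simp: is_bare_path_def)
  moreover have "ys \<noteq> []" using q v(2) p(3) ne by (auto simp: is_bare_path_def)
  ultimately have "0 < length xs" "0 < length ys" by auto
  then have "inner_segment (xs @ ?p @ ys) (length xs) (length xs + (length ?p - 1))"
    using q len by (simp add: inner_segment_def)
  moreover have "(xs @ ?p @ ys) ! length xs = u" "(xs @ ?p @ ys) ! (length xs + (length ?p - 1)) = v"
    using ends ne by (auto simp: nth_append)
  ultimately show ?thesis using that by blast
qed

lemma nonleaf_pairs:
  assumes G: "mid_separates mid_edges G"
    and u: "u \<in> V" "\<not> leaf E u" and v: "v \<in> V" "\<not> leaf E v" and uv: "u \<noteq> v" and ne: "supports \<noteq> {}"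
  shows "distinguishes (core_family \<union> G) u v"
proof (cases "u \<in> supports \<or> v \<in> supports")
  case True
  have *: "distinguishes core_family u v" if "u \<in> supports" "\<not> leaf E v" "u \<noteq> v" for u v
    using nonleaf_on_local_path[OF that(1,2)] in_local_path(1)[of u] in_core_family(1)[OF that(1)] that(3)
    by (auto intro: distinguishesI)
  have "distinguishes core_family u v" using True
  proof
    assume "u \<in> supports" then show ?thesis using * v(2) uv by blast
  next
    assume "v \<in> supports"
    then have "distinguishes core_family v u" using * u(2) uv by blast
    then show ?thesis by (rule distinguishes_sym)
  qed
  then show ?thesis by (rule distinguishes_mono) simp
next
  case False
  then have S: "u \<notin> supports" "v \<notin> supports" by auto
  obtain x where x: "{u, x} \<in> E" "v \<in> branch u x" using branch_exists[OF u(1) v(1)] uv by metis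
  obtain y where y: "{v, y} \<in> E" "u \<in> branch v y" using branch_exists[OF v(1) u(1)] uv by metis
  show ?thesis
  proof (cases "3 \<le> degree E u \<or> 3 \<le> degree E v \<or> supports \<inter> branch u x \<inter> branch v y \<noteq> {}")
    case True
    then consider "3 \<le> degree E u" | "3 \<le> degree E v"
      | t where "t \<in> supports" "t \<in> branch u x" "t \<in> branch v y" by blast
    then have "distinguishes core_family u v"
    proof cases
      case 1
      then show ?thesis using branching_distinguished[OF u(1) S(1) 1 v(1)] uv by simp
    next
      case 2
      then show ?thesis using branching_distinguished[OF v(1) S(2) 2 u(1)] uv distinguishes_sym by metis
    next
      case 3
      then show ?thesis using support_between_distinguished[OF S(1) u(2) S(2) v(2) x y] by blast
    qed
    then show ?thesis by (rule distinguishes_mono) simp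
  next
    case False
    have "degree E u = 2" "degree E v = 2"
      using False u(2) v(2) degree_pos[OF x(1)] degree_pos[OF y(1)] by (auto simp: leaf_def)
    then obtain q i j where q: "inner_segment q i j" "q ! i = u" "q ! j = v"
      using no_support_between_inner_segment[OF u(1) _ v(1) _ uv x y] False by blast
    have "{q ! i, q ! Suc i} \<in> between q i j" using q(1) by (auto simp: between_def inner_segment_def)
    then have "mid_edges \<inter> between q i j \<noteq> {}" using between_mid_edges[OF q(1)] by blast
    then obtain g where "g \<in> G" "(q ! i \<in> set g) \<noteq> (q ! j \<in> set g)"
      using G q(1) unfolding mid_separates_def by blast
    then show ?thesis using q by (auto simp: distinguishes_def)
  qed
qed

lemma core_leaves_leaf: "x \<in> core_leaves \<Longrightarrow> leaf E x"
  using leaf_abc(1-3) by (auto simp: core_leaves_def)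

lemma leaf_on_core_family:
  assumes "p \<in> core_family" "l \<in> set p" "leaf E l"
  shows "l \<in> core_leaves"
  using assms leaf_on_local_path leaf_on_ring_path leaf_abc(14)
  unfolding core_family_def core_leaves_def by blast

lemma card_core_leaves: "card core_leaves = 3 * card supports"
proof -
  have "inj_on a supports" "inj_on b supports" "inj_on c supports"
    using abc_owner by (auto intro!: inj_onI)
  moreover have ab: "a w \<noteq> b w'" if "w \<in> supports" "w' \<in> supports" for w w'
    using abc_owner[OF that, of "a w"] leaf_abc(8)[OF that(1)] by auto
  have ac: "a w \<noteq> c w'" if "w \<in> supports" "w' \<in> supports" for w w'
    using abc_owner[OF that, of "a w"] leaf_abc(10)[OF that(1)] by auto
  have "a ` supports \<inter> b ` supports = {}" using ab by fastforce
  moreover have "(a ` supports \<union> b ` supports) \<inter> c ` supports = {}"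
    using ac c_neq_b by fastforce
  ultimately show ?thesis
    using finite_supports by (simp add: core_leaves_def card_Un_disjoint card_image)
qed

lemma card_core_family: "card core_family \<le> 2 * card supports"
proof -
  have "card core_family \<le> card (local_path ` supports) + card (ring_path ` supports)"
    unfolding core_family_def by (rule card_Un_le)
  also have "\<dots> \<le> card supports + card supports"
    using finite_supports by (intro add_mono card_image_le)
  finally show ?thesis by simp
qed

lemma core_family_covers:
  assumes "v \<in> V" "leaf E v \<Longrightarrow> v \<in> core_leaves" "supports \<noteq> {}"
  shows "\<exists>p\<in>core_family. v \<in> set p"
proof (cases "leaf E v")
  case True
  then consider w where "w \<in> supports" "v = a w \<or> v = c w" | w where "w \<in> supports" "v = b w"
    using assms(2) by (auto simp: core_leaves_def)
  then show ?thesis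
  proof cases
    case 1
    then show ?thesis using in_local_path in_core_family(1) by blast
  next
    case 2
    then show ?thesis using ring_predecessor ring_path(5) in_core_family(2) by blast
  qed
next
  case False
  show ?thesis
  proof (cases "v \<in> supports")
    case True
    then show ?thesis using in_local_path in_core_family(1) by blast
  next
    case F: False
    then show ?thesis using two_ring_paths[OF assms(1) F False assms(3)] in_core_family(2) by blast
  qed
qed

text \<open>A star is the only tree in which the core family needs help beyond the vertices of degree two:
  its centre lies on the same two core paths as one of the leaves.\<close>

lemma extra_family_exists:
  assumes ne: "supports \<noteq> {}"
  shows "\<exists>G. finite G \<and> card G \<le> card mid_edges div 2 + 1 \<and> (\<forall>p\<in>G. is_path V E p) \<and>
    (\<forall>u\<in>V. \<forall>v\<in>V. \<not> leaf E u \<and> (leaf E v \<longrightarrow> v \<in> core_leaves) \<and> u \<noteq> v \<longrightarrow>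
       distinguishes (core_family \<union> G) u v)"
proof (cases "\<exists>w. supports = {w}")
  case True
  then obtain w where w: "supports = {w}" by blast
  have nl: "u = w" if u: "u \<in> V" "\<not> leaf E u" for u
  proof (rule ccontr)
    assume "u \<noteq> w"
    then show False using two_ring_paths[OF u(1) _ u(2) ne] w by auto
  qed
  have "distinguishes (core_family \<union> {[w]}) u v"
    if "u \<in> V" "v \<in> V" "\<not> leaf E u" "u \<noteq> v" for u v
    using nl that by (intro distinguishesI[of "[w]"]) auto
  moreover have "is_path V E [w]" using supports_in_V w by (simp add: is_path_def)
  ultimately show ?thesis by (intro exI[of _ "{[w]}"]) auto
next
  case False
  have two: "f w \<noteq> w" if w: "w \<in> supports" for w
  proof -
    obtain z where "z \<in> supports" "z \<noteq> w" using False w by blast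
    then show ?thesis using ring_exit[OF ring w, of "{w}" z] by auto
  qed
  obtain w where w: "w \<in> supports" using ne by blast
  have "{w, a w} \<notin> mid_edges" using leaf_abc(1)[OF w] by (auto simp: mid_edges_def leaf_def)
  then obtain G where G: "finite G" "card G \<le> card mid_edges div 2 + 1" "\<forall>p\<in>G. is_path V E p"
    "mid_separates mid_edges G"
    using mid_family_exists[OF leaf_abc(4)[OF w] _ order_refl] by blast
  have "distinguishes (core_family \<union> G) u v"
    if h: "u \<in> V" "v \<in> V" "\<not> leaf E u" "leaf E v \<longrightarrow> v \<in> core_leaves" "u \<noteq> v" for u v
  proof (cases "leaf E v")
    case True
    then have "distinguishes core_family v u" using core_leaf_vs_nonleaf[OF _ h(1,3) two] h(4) by blast
    from distinguishes_sym[OF this] show ?thesis by (rule distinguishes_mono) simp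
  next
    case False
    then show ?thesis using nonleaf_pairs[OF G(4) h(1,3,2) _ h(5) ne] by blast
  qed
  then show ?thesis using G by blast
qed

text \<open>With \<open>s\<close> supports the core uses \<open>2 * s\<close> paths for
  \<open>3 * s\<close> leaves, so rounding concerns only the other leaves:
  \<open>2 * s + (2 * card X + 2) div 3\<close> equals
  \<open>(2 * (3 * s + card X) + 2) div 3\<close>.\<close>

lemma sp_star_upper_bound_core:
  assumes ne: "supports \<noteq> {}"
  shows "sp_star V E (Vertex ` V) \<le> (2 * h1 V E + 2) div 3 + (card mid_edges div 2 + 1)"
proof -
  let ?L = "{v \<in> V. leaf E v}"
  define X where "X = ?L - core_leaves"
  have fX: "finite X" and fL: "finite ?L" using finite_V by (auto simp: X_def)
  have sub: "core_leaves \<subseteq> ?L" using core_leaves_leaf leaf_in_V by blast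
  have "card ?L = card core_leaves + card X"
    using card_Diff_subset[OF finite_subset[OF sub fL] sub] card_mono[OF fL sub] by (simp add: X_def)
  then have h1: "h1 V E = 3 * card supports + card X" by (simp add: h1_def card_core_leaves)
  obtain H where H: "finite H" "card H \<le> (2 * card X + 2) div 3" "\<forall>p\<in>H. is_path V E p"
    "\<forall>x\<in>X. \<exists>p\<in>H. x \<in> set p" "\<forall>x\<in>X. \<forall>y\<in>X. x \<noteq> y \<longrightarrow> distinguishes H x y"
    using leaf_family_exists[OF fX] by (auto simp: X_def)
  obtain G where G: "finite G" "card G \<le> card mid_edges div 2 + 1" "\<forall>p\<in>G. is_path V E p"
    "\<And>u v. u \<in> V \<Longrightarrow> v \<in> V \<Longrightarrow> \<not> leaf E u \<Longrightarrow> (leaf E v \<Longrightarrow> v \<in> core_leaves) \<Longrightarrow> u \<noteq> v \<Longrightarrow>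
       distinguishes (core_family \<union> G) u v"
    using extra_family_exists[OF ne] by blast
  let ?F = "core_family \<union> H \<union> G"
  have core: "leaf E v \<Longrightarrow> v \<in> core_leaves" if "v \<in> V" "v \<notin> X" for v using that by (auto simp: X_def)
  have "sp_star V E (Vertex ` V) \<le> card ?F"
  proof (rule sp_star_le_card)
    show "finite ?F" using finite_supports H(1) G(1) by (simp add: core_family_def)
    show "is_path V E p" if "p \<in> ?F" for p
      using that local_path ring_path(1) H(3) G(3) by (auto simp: core_family_def)
    show "\<exists>p\<in>?F. v \<in> set p" if v: "v \<in> V" for v
      using H(4) core_family_covers[OF v core[OF v] ne] by blast
  next
    fix u v assume uv: "u \<in> V" "v \<in> V" "u \<noteq> v"
    \<comment> \<open>Leaves in \<open>X\<close> lie on no core path and every other vertex lies on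
      one, so the leaf family \<open>H\<close> has to separate only within \<open>X\<close>.\<close>
    have X1: "distinguishes core_family v x" if x: "x \<in> X" and v: "v \<in> V" "v \<notin> X" for x v
    proof -
      obtain p where p: "p \<in> core_family" "v \<in> set p" using core_family_covers[OF v(1) core[OF v] ne] by blast
      have "x \<notin> set p" using leaf_on_core_family[OF p(1)] x by (auto simp: X_def)
      then show ?thesis using p by (auto intro: distinguishesI)
    qed
    consider "u \<in> X" "v \<in> X" | "u \<in> X" "v \<notin> X" | "u \<notin> X" "v \<in> X"
      | "u \<notin> X" "v \<notin> X" "leaf E u" "leaf E v" | "u \<notin> X" "v \<notin> X" "\<not> leaf E u"
      | "u \<notin> X" "v \<notin> X" "\<not> leaf E v"
      by blast
    then show "distinguishes ?F u v"
    proof cases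
      case 1
      then show ?thesis using H(5) uv(3) distinguishes_mono[of H u v ?F] by blast
    next
      case 2
      then show ?thesis
        using distinguishes_sym[OF X1[OF 2(1) uv(2) 2(2)]] distinguishes_mono[of core_family u v ?F] by blast
    next
      case 3
      then show ?thesis using X1[OF 3(2) uv(1) 3(1)] distinguishes_mono[of core_family u v ?F] by blast
    next
      case 4
      then have "distinguishes core_family u v"
        using core_leaf_pairs core uv by blast
      then show ?thesis using distinguishes_mono[of core_family u v ?F] by blast
    next
      case 5
      then have "distinguishes (core_family \<union> G) u v" using G(4)[OF uv(1,2)] core[OF uv(2)] uv(3) by blast
      then show ?thesis by (rule distinguishes_mono) auto
    next
      case 6
      then have "distinguishes (core_family \<union> G) v u" using G(4)[OF uv(2,1)] core[OF uv(1)] uv(3) by blast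
      from distinguishes_sym[OF this] show ?thesis by (rule distinguishes_mono) auto
    qed
  qed
  also have "\<dots> \<le> card core_family + card H + card G"
    using card_Un_le[of "core_family \<union> H" G] card_Un_le[of core_family H] by linarith
  also have "\<dots> \<le> (2 * h1 V E + 2) div 3 + (card mid_edges div 2 + 1)"
    using card_core_family H(2) G(2) h1 by linarith
  finally show ?thesis .
qed

end

lemma (in bushy_tree) sp_star_upper_bound:
  "sp_star V E (Vertex ` V) \<le> (2 * h1 V E + 2) div 3 + (h2_star V E div 2 + 1)"
proof (cases "supports = {}")
  case True
  \<comment> \<open>The tree is a single vertex, and the summand 1 pays for its one path.\<close>
  then obtain r where r: "V = {r}" using no_supports by blast
  have "sp_star V E (Vertex ` V) \<le> card {[r]}"
    by (rule sp_star_le_card) (auto simp: r is_path_def)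
  then show ?thesis by simp
next
  case False
  obtain f where f: "ring supports f" using ring_exists[of supports] supports_in_V False by blast
  obtain a b c where abc: "\<forall>w\<in>supports. {a w, b w, c w} \<subseteq> {l. leaf E l \<and> {w, l} \<in> E} \<and>
     a w \<noteq> b w \<and> b w \<noteq> c w \<and> a w \<noteq> c w"
    using three_leaves_exist by blast
  interpret ring_family V E a b c f
    by unfold_locales (use abc f in auto)
  show ?thesis
    using sp_star_upper_bound_core[OF False] div_le_mono[OF card_mid_edges, of 2] by linarith
qed

theorem theorem3p4:
  fixes V :: "'a set" and E :: "'a set set"
  assumes "is_tree V E"
  shows "int (sp_star V E (Vertex ` V)) \<ge>
           max \<lceil>(2 * real (h1 V E) + real (h2_star V E)) / 3\<rceil>
               \<lceil>(real (h1 V E) + real (h2_star V E)) / 2\<rceil>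
       \<and> ((\<forall>B \<in> bunches V E. bunch_size E B \<ge> 3) \<and> \<not> is_star 3 V E \<longrightarrow>
           int (sp_star V E (Vertex ` V)) \<le>
             \<lceil>2 * real (h1 V E) / 3\<rceil> + \<lceil>(real (h2_star V E) + 1) / 2\<rceil>)"
proof (intro conjI impI)
  interpret tree V E using assms by unfold_locales
  have "real (2 * h1 V E + h2_star V E) \<le> real (3 * sp_star V E (Vertex ` V))"
    "real (h1 V E + h2_star V E) \<le> real (2 * sp_star V E (Vertex ` V))"
    using sp_star_lower_bounds unfolding of_nat_le_iff by blast+
  then show "max \<lceil>(2 * real (h1 V E) + real (h2_star V E)) / 3\<rceil>
      \<lceil>(real (h1 V E) + real (h2_star V E)) / 2\<rceil> \<le> int (sp_star V E (Vertex ` V))"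
    by (simp add: ceiling_le_iff)
next
  assume h: "(\<forall>B \<in> bunches V E. bunch_size E B \<ge> 3) \<and> \<not> is_star 3 V E"
  interpret bushy_tree V E using assms h by unfold_locales auto
  \<comment> \<open>Integer forms of the ceilings: \<open>(2 * h + 2) div 3\<close> is two thirds of
    \<open>h\<close> rounded up, and in \<open>b\<close> below \<open>h div 2 + 1\<close> is half of
    \<open>h + 1\<close> rounded up.\<close>
  have a: "int ((2 * h + 2) div 3) \<le> \<lceil>2 * real h / 3\<rceil>" for h
  proof -
    have "3 * ((2 * h + 2) div 3) \<le> 2 * h + 2" by simp
    then have "real (3 * ((2 * h + 2) div 3)) \<le> real (2 * h + 2)" by (simp only: of_nat_le_iff)
    then have "real_of_int (int ((2 * h + 2) div 3) - 1) < 2 * real h / 3" by simp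
    then show ?thesis by (simp only: less_ceiling_iff[symmetric])
  qed
  have b: "int (h div 2 + 1) \<le> \<lceil>(real h + 1) / 2\<rceil>" for h
  proof -
    have "2 * (h div 2) \<le> h" by simp
    then have "real (2 * (h div 2)) \<le> real h" by (simp only: of_nat_le_iff)
    then have "real_of_int (int (h div 2)) < (real h + 1) / 2" by simp
    then have "int (h div 2) < \<lceil>(real h + 1) / 2\<rceil>" by (simp only: less_ceiling_iff)
    then show ?thesis by linarith
  qed
  have "int (sp_star V E (Vertex ` V)) \<le> int ((2 * h1 V E + 2) div 3 + (h2_star V E div 2 + 1))"
    using sp_star_upper_bound by (simp only: of_nat_le_iff)
  then show "int (sp_star V E (Vertex ` V)) \<le>
      \<lceil>2 * real (h1 V E) / 3\<rceil> + \<lceil>(real (h2_star V E) + 1) / 2\<rceil>"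
    using a[of "h1 V E"] b[of "h2_star V E"] by linarith
qed

end
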